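(* Let $\theta_0=(\mathbf W_0,\sigma_0^2)\in\Theta$ be the true parameter and let $X_1,X_2,\ldots$ be i.i.d. random vectors in $\mathbb R^p$ with density $f(\cdot;\theta_0)$. For each $n$ let $\theta_n=\theta_n(X_1,\ldots,X_n)\in\Theta$ be a measurable function of the observations, and suppose there is a constant $c>0$ such that $$\prod_{i=1}^{n}\frac{f(X_i;\theta_n)}{f(X_i;\theta_0)}\geq c>0\quad\text{for all } n.$$ Then $\mathbb P\left(\lim_{n}[\theta_n]=[\theta_0]\right)=1$, i.e. $[\theta_n]$ converges to $[\theta_0]$ in $(\Theta/C,\bar d)$ almost surely, and therefore in probability.
   Context: Let $p>q$ be positive integers, $\mathbb R_+=(0,\infty)$, and $\Theta=\{\theta=(\mathbf W_\theta,\sigma_\theta^2)\in\mathbb R^{p\times q}\times\mathbb R_+\}$, viewed as a subset of $\mathbb R^{pq+1}$ with the Euclidean metric $d$. For $\theta\in\Theta$, $f(\cdot;\theta)$ is the density on $\mathbb R^p$ of the normal distribution $\mathcal N(0,\mathbf W_\theta\mathbf W_\theta^T+\sigma_\theta^2 I_p)$ (the marginal density of the probabilistic PCA model). For a fixed true parameter $\theta_0=(\mathbf W_0,\sigma_0^2)\in\Theta$, let $C=\{\theta\in\Theta:\mathbf W_\theta\mathbf W_\theta^T+\sigma_\theta^2I_p=\mathbf W_0\mathbf W_0^T+\sigma_0^2I_p\}$, a closed subset of $\Theta$. $\Theta/C$ is the quotient of $\Theta$ by the equivalence relation $\theta\sim\phi$ iff $\theta=\phi$ or $\theta,\phi\in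 C$; $[\theta]$ denotes the class of $\theta$. It carries the metric $\bar d([\theta],[\phi])=\min\big(d(\theta,\phi),\,d(\theta,C)+d(\phi,C)\big)$, where $d(\theta,C)=\inf_{c\in C}d(\theta,c)$. Convergence in $\Theta/C$ is with respect to $\bar d$. $\mathbb P$ is the probability under $\theta_0$. *)

theory Defs
  imports "HOL-Probability.Probability"
begin

text \<open>
  The index types \<open>'p\<close> and \<open>'q\<close> stand for the dimensions $p$ and $q$.  The
  product metric on \<open>(real ^ 'q ^ 'p) \<times> real\<close> is the Euclidean metric of $R^{pq+1}$.
\<close>

type_synonym ('p, 'q) param = "(real ^ 'q ^ 'p) \<times> real"

definition Theta :: "('p::finite, 'q::finite) param set" where
  "Theta = UNIV \<times> {0<..}"

definition model_cov :: "('p::finite, 'q::finite) param \<Rightarrow> real ^ 'p ^ 'p" where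
  "model_cov \<theta> = fst \<theta> ** transpose (fst \<theta>) + snd \<theta> *\<^sub>R mat 1"

definition mvn_density :: "real ^ 'p \<Rightarrow> real ^ 'p ^ 'p \<Rightarrow> real ^ 'p \<Rightarrow> real" where
  "mvn_density \<mu> \<Sigma> x =
     exp (- ((x - \<mu>) \<bullet> (matrix_inv \<Sigma> *v (x - \<mu>))) / 2) / sqrt ((2 * pi) ^ CARD('p) * det \<Sigma>)"

definition ppca_density :: "real ^ 'p \<Rightarrow> ('p::finite, 'q::finite) param \<Rightarrow> real" where
  "ppca_density x \<theta> = mvn_density 0 (model_cov \<theta>) x"

definition true_set :: "('p::finite, 'q::finite) param \<Rightarrow> ('p, 'q) param set" where
  "true_set \<theta>\<^sub>0 = {\<theta> \<in> Theta. model_cov \<theta> = model_cov \<theta>\<^sub>0}"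


definition collapse_rel :: "'a set \<Rightarrow> 'a set \<Rightarrow> ('a \<times> 'a) set" where
  "collapse_rel S C = {(x, y). x \<in> S \<and> y \<in> S \<and> (x = y \<or> x \<in> C \<and> y \<in> C)}"

definition collapse :: "'a set \<Rightarrow> 'a set \<Rightarrow> 'a set set" where
  "collapse S C = S // collapse_rel S C"

definition collapse_class :: "'a set \<Rightarrow> 'a set \<Rightarrow> 'a \<Rightarrow> 'a set" where
  "collapse_class S C x = collapse_rel S C `` {x}"

text \<open>
  The value does not depend on the chosen representatives when \<open>A\<close> and \<open>B\<close> are classes:
  see \<open>collapse_dist_class\<close>.
\<close>

definition collapse_dist :: "'a::metric_space set \<Rightarrow> 'a set \<Rightarrow> 'a set \<Rightarrow> real" where
  "collapse_dist C A B =
     (let x = (SOME x. x \<in> A); y = (SOME y. y \<in> B)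
      in min (dist x y) (infdist x C + infdist y C))"

lemma equiv_collapse_rel: "C \<subseteq> S \<Longrightarrow> equiv S (collapse_rel S C)"
  by (intro equivI) (auto simp: collapse_rel_def refl_on_def sym_def trans_def)

lemma collapse_eq: "collapse S C = collapse_class S C ` S"
  by (auto simp: collapse_def collapse_class_def quotient_def)

lemma collapse_class_eq_iff:
  assumes "C \<subseteq> S" "x \<in> S" "y \<in> S"
  shows "collapse_class S C x = collapse_class S C y \<longleftrightarrow> x = y \<or> x \<in> C \<and> y \<in> C"
  using assms by (auto simp: collapse_class_def collapse_rel_def)

lemma collapse_dist_class:
  assumes "C \<subseteq> S" "x \<in> S" "y \<in> S"
  shows "collapse_dist C (collapse_class S C x) (collapse_class S C y)
           = min (dist x y) (infdist x C + infdist y C)"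
proof -
  have inv: "min (dist u v) (infdist u C + infdist v C) = min (dist x y) (infdist x C + infdist y C)"
    if "u \<in> collapse_class S C x" "v \<in> collapse_class S C y" for u v
  proof -
    have u: "u = x \<or> (x \<in> C \<and> u \<in> C)" and v: "v = y \<or> (y \<in> C \<and> v \<in> C)"
      using that by (auto simp: collapse_class_def collapse_rel_def)
    have le1: "infdist a C \<le> dist a b" "infdist a C \<le> dist b a" if "b \<in> C" for a b
      using infdist_le[OF that, of a] by (auto simp: dist_commute)
    show ?thesis
      using u v by (auto simp: min_def dist_commute intro!: antisym dest: le1)
        (metis add.right_neutral add.left_neutral infdist_zero le1 dist_commute antisym zero_le_dist)+
  qed
  have "x \<in> collapse_class S C x" "y \<in> collapse_class S C y"
    using assms by (auto simp: collapse_class_def collapse_rel_def)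
  then have "(SOME u. u \<in> collapse_class S C x) \<in> collapse_class S C x"
      "(SOME v. v \<in> collapse_class S C y) \<in> collapse_class S C y"
    by (metis someI)+
  then show ?thesis
    unfolding collapse_dist_def Let_def by (rule inv)
qed

lemma Metric_space_collapse:
  assumes CS: "C \<subseteq> S" and ne: "C \<noteq> {}" and cl: "closedin (top_of_set S) C"
  shows "Metric_space (collapse S C) (collapse_dist C)"
proof
  show "0 \<le> collapse_dist C A B" for A B
    by (simp add: collapse_dist_def Let_def infdist_nonneg)
  show "collapse_dist C A B = collapse_dist C B A" for A B
    by (simp add: collapse_dist_def Let_def dist_commute add.commute)
next
  fix A B assume "A \<in> collapse S C" "B \<in> collapse S C"
  then obtain x y where x: "x \<in> S" "A = collapse_class S C x"
    and y: "y \<in> S" "B = collapse_class S C y"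
    by (auto simp: collapse_eq)
  have z: "infdist u C = 0 \<longleftrightarrow> u \<in> C" if "u \<in> S" for u
  proof -
    obtain K where K: "closed K" "C = S \<inter> K"
      using cl by (auto simp: closedin_closed)
    then have "closure C \<subseteq> K"
      by (intro closure_minimal) auto
    then have "u \<in> closure C \<longleftrightarrow> u \<in> C"
      using K that closure_subset[of C] by auto
    then show ?thesis
      using in_closure_iff_infdist_zero[OF ne, of u] by simp
  qed
  show "collapse_dist C A B = 0 \<longleftrightarrow> A = B"
    using z[OF x(1)] z[OF y(1)] infdist_nonneg[of x C] infdist_nonneg[of y C] zero_le_dist[of x y]
    by (auto simp: x(2) y(2) collapse_dist_class[OF CS x(1) y(1)]
        collapse_class_eq_iff[OF CS x(1) y(1)] min_def split: if_splits)
next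
  fix A B D assume "A \<in> collapse S C" "B \<in> collapse S C" "D \<in> collapse S C"
  then obtain x y w where x: "x \<in> S" "A = collapse_class S C x"
    and y: "y \<in> S" "B = collapse_class S C y" and w: "w \<in> S" "D = collapse_class S C w"
    by (auto simp: collapse_eq)
  show "collapse_dist C A D \<le> collapse_dist C A B + collapse_dist C B D"
    unfolding x(2) y(2) w(2) collapse_dist_class[OF CS x(1) y(1)]
      collapse_dist_class[OF CS x(1) w(1)] collapse_dist_class[OF CS y(1) w(1)]
    using dist_triangle[of x w y] infdist_triangle[of x C y] infdist_triangle[of w C y]
      infdist_nonneg[of y C] dist_commute[of w y]
    by linarith
qed

lemma Metric_space_true_set:
  fixes \<theta>\<^sub>0 :: "('p::finite, 'q::finite) param"
  assumes "\<theta>\<^sub>0 \<in> Theta"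
  shows "Metric_space (collapse Theta (true_set \<theta>\<^sub>0)) (collapse_dist (true_set \<theta>\<^sub>0))"
proof (rule Metric_space_collapse)
  have "continuous_on UNIV (model_cov :: ('p, 'q) param \<Rightarrow> _)"
    unfolding model_cov_def matrix_matrix_mult_def transpose_def
    by (intro continuous_intros)
  then have "closed (model_cov -` {model_cov \<theta>\<^sub>0} :: ('p, 'q) param set)"
    by (intro closed_vimage) auto
  then show "closedin (top_of_set Theta) (true_set \<theta>\<^sub>0)"
    by (auto simp: closedin_closed true_set_def)
next
  have "\<theta>\<^sub>0 \<in> true_set \<theta>\<^sub>0"
    using assms by (simp add: true_set_def)
  then show "true_set \<theta>\<^sub>0 \<noteq> {}"
    by blast
qed (auto simp: true_set_def)

end

theory Submission
  imports Defs
begin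

text \<open>
  The log-likelihood of a centred Gaussian depends on the data only through the sample covariance,
  which converges to the true covariance almost surely by a strong law of large numbers.
  After whitening, a covariance with eigenvalues \<open>e\<^sub>k\<close> has normalised deviance at least
  \<open>\<Sum>\<^sub>k (s\<^sub>k - 1 - ln s\<^sub>k)\<close> up to an error tending to \<open>0\<close>, where \<open>s\<^sub>k\<close> is \<open>1 / e\<^sub>k\<close> up to a factor
  tending to \<open>1\<close>.  The likelihood assumption bounds the deviance by \<open>O(1 / n)\<close>, so all \<open>e\<^sub>k\<close> tend to
  \<open>1\<close>: the fitted covariances converge to the true one.  Compactness then gives convergence of the
  distance to \<open>C\<close>, which dominates the quotient distance to \<open>[\<theta>\<^sub>0]\<close>.
\<close>

section \<open>Diagonalization of symmetric and positive definite matrices\<close>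

text \<open>The obstacle is that \<open>Theta\<close> is neither closed nor bounded, while the
  estimators are arbitrary measurable maps subject only to a likelihood inequality; they might drift
  to infinity or to zero noise variance. Rather than compactifying the parameter space and bounding
  suprema of likelihood ratios, the argument controls covariances first: s - 1 - ln s blows up as s
  tends to 0 or to infinity, so one bound excludes both collapsing and exploding eigenvalues.
  Compactness is used only afterwards, for parameters whose norm is controlled by the trace of the
  covariance. The eigenvectors of the fitted covariance depend on the sample, so limits along fixed
  directions would not suffice; the finitely many entries of the whitened sample second moment
  control all directions at once. This part is deterministic, for one sample path. The probabilistic
  input is the law of large numbers for products of two Gaussian linear forms; fourth moments of
  such products call for moments of order eight, which exponential moments dominate.\<close>

lemma dot_matrix_vector_transpose:
  fixes A :: "real^'n^'m"
  shows "x \<bullet> (A *v y) = (transpose A *v x) \<bullet> y"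
  by (simp add: dot_lmul_matrix)

text \<open>A maximiser of the quadratic form on the unit sphere of an invariant subspace is an eigenvector.\<close>

lemma symmetric_matrix_has_eigenvector:
  fixes A :: "real^'n^'n"
  assumes sym: "transpose A = A" and V: "subspace V" and inv: "\<And>x. x \<in> V \<Longrightarrow> A *v x \<in> V"
    and ne: "V \<noteq> {0}"
  shows "\<exists>x l. x \<in> V \<and> norm x = 1 \<and> A *v x = l *\<^sub>R x"
proof -
  obtain v where v: "v \<in> V" "v \<noteq> 0"
    using ne subspace_0[OF V] by blast
  have "compact (V \<inter> sphere 0 1)"
    by (intro closed_Int_compact closed_subspace V compact_sphere)
  moreover have "(1 / norm v) *\<^sub>R v \<in> V \<inter> sphere 0 1"
    using v V by (auto simp: subspace_scale)
  moreover have "continuous_on (V \<inter> sphere 0 1) (\<lambda>x. x \<bullet> (A *v x))"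
    by (intro continuous_intros)
  ultimately have "\<exists>x\<in>V \<inter> sphere 0 1. \<forall>y\<in>V \<inter> sphere 0 1. y \<bullet> (A *v y) \<le> x \<bullet> (A *v x)"
    using continuous_attains_sup[of "V \<inter> sphere 0 1" "\<lambda>x. x \<bullet> (A *v x)"]
    by blast
  then obtain x where x: "x \<in> V" "norm x = 1"
      and max: "\<And>y. y \<in> V \<Longrightarrow> norm y = 1 \<Longrightarrow> y \<bullet> (A *v y) \<le> x \<bullet> (A *v x)"
    by auto
  define l where "l = x \<bullet> (A *v x)"
  have le: "y \<bullet> (A *v y) \<le> l * (y \<bullet> y)" if "y \<in> V" for y
  proof (cases "y = 0")
    case False
    have "((1 / norm y) *\<^sub>R y) \<bullet> (A *v ((1 / norm y) *\<^sub>R y)) \<le> l"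
      unfolding l_def using False that V by (intro max) (auto simp: subspace_scale)
    then have "(y \<bullet> (A *v y)) / (norm y)\<^sup>2 \<le> l"
      by (simp add: matrix_vector_mult_scaleR power2_eq_square)
    then show ?thesis
      using False by (simp add: field_simps power2_norm_eq_inner)
  qed simp
  have xx: "x \<bullet> x = 1"
    using x by (simp add: norm_eq_1)
  \<comment> \<open>The residual \<open>y\<close> is orthogonal to \<open>x\<close>. Moving from
    \<open>x\<close> to \<open>x + t *\<^sub>R y\<close> changes the form to first order by
    \<open>2 * t * (y \<bullet> y)\<close> and otherwise only by terms in \<open>t\<^sup>2\<close>,
    so a nonzero \<open>y\<close> would contradict maximality.\<close>
  define y where "y = A *v x - l *\<^sub>R x"
  have yV: "y \<in> V"
    unfolding y_def using x inv V by (simp add: subspace_diff subspace_scale)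
  have xy: "x \<bullet> y = 0"
    by (simp add: y_def inner_diff_right xx l_def)
  then have yx: "y \<bullet> x = 0"
    by (simp only: inner_commute)
  have "A *v x = y + l *\<^sub>R x"
    by (simp add: y_def)
  then have yy: "y \<bullet> (A *v x) = y \<bullet> y"
    by (simp add: inner_add_right yx)
  have "x \<bullet> (A *v y) = (A *v x) \<bullet> y"
    by (simp only: dot_matrix_vector_transpose[of x A y] sym)
  then have xAy: "x \<bullet> (A *v y) = y \<bullet> y"
    by (simp only: inner_commute[of "A *v x"] yy)
  define K where "K = l * (y \<bullet> y) - y \<bullet> (A *v y)"
  have *: "2 * t * (y \<bullet> y) \<le> t\<^sup>2 * K" for t
  proof -
    have "x + t *\<^sub>R y \<in> V"
      using x yV V by (simp add: subspace_add subspace_scale)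
    from le[OF this] show ?thesis
      by (simp add: matrix_vector_right_distrib matrix_vector_mult_scaleR inner_add_left
          inner_add_right xAy yy xx xy yx l_def[symmetric] K_def power2_eq_square algebra_simps)
  qed
  have "y \<bullet> y = 0"
  proof (rule ccontr)
    assume "y \<bullet> y \<noteq> 0"
    then have pos: "y \<bullet> y > 0" by simp
    \<comment> \<open>Chosen so that \<open>t * K\<close> is at most \<open>y \<bullet> y\<close>,
      short of the required \<open>2 * (y \<bullet> y)\<close>.\<close>
    define t where "t = (y \<bullet> y) / (\<bar>K\<bar> + 1)"
    have t: "t > 0" using pos by (simp add: t_def)
    have "2 * (y \<bullet> y) \<le> t * K"
      using *[of t] t by (simp add: power2_eq_square)
    also have "\<dots> \<le> t * (\<bar>K\<bar> + 1)"
      using t by (intro mult_left_mono) auto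
    also have "\<dots> = y \<bullet> y" by (simp add: t_def)
    finally show False using pos by simp
  qed
  then have "A *v x = l *\<^sub>R x"
    by (simp add: y_def)
  then show ?thesis using x by blast
qed

text \<open>Induction on the dimension: split off one eigenvector \<open>x\<close>; symmetry makes
  its orthogonal complement in \<open>V\<close> invariant again. Invariant subspaces, instead of the
  whole space, keep the induction within vectors of one type.\<close>

lemma symmetric_matrix_eigenbasis:
  fixes A :: "real^'n^'n"
  assumes sym: "transpose A = A" and "subspace V" and "\<And>x. x \<in> V \<Longrightarrow> A *v x \<in> V"
  shows "\<exists>B. B \<subseteq> V \<and> V \<subseteq> span B \<and> pairwise orthogonal B \<and>
           (\<forall>b\<in>B. norm b = 1 \<and> (\<exists>l. A *v b = l *\<^sub>R b))"
  using assms(2,3)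
proof (induction "dim V" arbitrary: V rule: less_induct)
  case less
  show ?case
  proof (cases "V = {0}")
    case True
    then show ?thesis by (intro exI[of _ "{}"]) auto
  next
    case False
    then obtain x l where x: "x \<in> V" "norm x = 1" "A *v x = l *\<^sub>R x"
      using symmetric_matrix_has_eigenvector[OF sym less.prems] by blast
    define V' where "V' = V \<inter> {y. orthogonal x y}"
    have sub: "subspace V'"
      unfolding V'_def by (intro subspace_inter less.prems subspace_orthogonal_to_vector)
    have "x \<notin> V'"
      using x by (auto simp: V'_def orthogonal_def norm_eq_1)
    then have "V' \<subset> V"
      using x by (auto simp: V'_def)
    then have dim: "dim V' < dim V"
      using sub less.prems(1) by (intro dim_psubset) (simp add: span_eq_iff[THEN iffD2])
    have inv: "A *v y \<in> V'" if "y \<in> V'" for y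
    proof -
      have "x \<bullet> (A *v y) = (A *v x) \<bullet> y"
        using dot_matrix_vector_transpose[of x A y] by (simp only: sym)
      then show ?thesis
        using that less.prems(2) by (auto simp: V'_def orthogonal_def x)
    qed
    obtain B where B: "B \<subseteq> V'" "V' \<subseteq> span B" "pairwise orthogonal B"
        "\<forall>b\<in>B. norm b = 1 \<and> (\<exists>l. A *v b = l *\<^sub>R b)"
      using less.hyps[OF dim sub inv] by blast
    have "V \<subseteq> span (insert x B)"
    proof
      fix v assume v: "v \<in> V"
      have "v - (x \<bullet> v) *\<^sub>R x \<in> V'"
        using v x less.prems(1)
        by (auto simp: V'_def orthogonal_def inner_diff_right norm_eq_1 subspace_diff subspace_scale)
      then show "v \<in> span (insert x B)"
        using B(2) by (auto simp: span_insert)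
    qed
    moreover have "pairwise orthogonal (insert x B)"
      using B by (auto simp: pairwise_insert V'_def orthogonal_commute)
    ultimately show ?thesis
      using B x by (intro exI[of _ "insert x B"]) (auto simp: V'_def)
  qed
qed

section \<open>Diagonal matrices and orthogonal diagonalization\<close>

definition diag_mat :: "('n::finite \<Rightarrow> real) \<Rightarrow> real^'n^'n" where
  "diag_mat d = (\<chi> i j. if i = j then d i else 0)"

lemma diag_mat_vector: "diag_mat d *v x = (\<chi> i. d i * x $ i)"
proof -
  have "(\<Sum>j\<in>UNIV. (if i = j then d i else 0) * x $ j) = (\<Sum>j\<in>UNIV. if i = j then d j * x $ j else 0)" for i
    by (intro sum.cong) auto
  then show ?thesis
    by (simp add: vec_eq_iff diag_mat_def matrix_vector_mult_def)
qed

lemma diag_mat_mult: "diag_mat d ** diag_mat e = diag_mat (\<lambda>i. d i * e i)"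
  by (simp add: matrix_eq matrix_vector_mul_assoc[symmetric] diag_mat_vector mult.assoc)

lemma transpose_diag_mat [simp]: "transpose (diag_mat d) = diag_mat d"
  by (auto simp: diag_mat_def transpose_def vec_eq_iff)

lemma diag_mat_one [simp]: "diag_mat (\<lambda>i. 1) = mat 1"
  by (auto simp: diag_mat_def mat_def vec_eq_iff)

lemma det_diag_mat: "det (diag_mat d) = (\<Prod>i\<in>UNIV. d i)"
  by (subst det_diagonal) (auto simp: diag_mat_def)

theorem symmetric_matrix_diagonalization:
  fixes A :: "real^'n^'n"
  assumes sym: "transpose A = A"
  shows "\<exists>V d. orthogonal_matrix V \<and> transpose V ** A ** V = diag_mat d"
proof -
  obtain B where B: "UNIV \<subseteq> span B" "pairwise orthogonal B"
      "\<forall>b\<in>B. norm b = 1 \<and> (\<exists>l. A *v b = l *\<^sub>R b)"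
    using symmetric_matrix_eigenbasis[OF sym, of UNIV] by auto
  have ind: "independent B"
    using B by (intro pairwise_orthogonal_independent) auto
  have "card B = dim (UNIV :: (real^'n) set)"
    using B(1) ind by (intro basis_card_eq_dim) auto
  then have card: "card B = CARD('n)" by simp
  moreover have "finite B" using ind by (rule independent_imp_finite)
  ultimately obtain v where v: "bij_betw v (UNIV :: 'n set) B"
    by (metis finite_same_card_bij finite)
  have vB: "v i \<in> B" for i using v by (auto simp: bij_betw_def)
  have orth: "v i \<bullet> v j = (if i = j then 1 else 0)" for i j
  proof (cases "i = j")
    case True
    then show ?thesis
      using vB[of j] B(3) by (simp add: norm_eq_1)
  next
    case False
    then have "v i \<noteq> v j"
      using v by (simp add: bij_betw_def inj_eq)
    then show ?thesis
      using False B(2) vB by (simp add: pairwise_def orthogonal_def)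
  qed
  have "\<forall>i. \<exists>l. A *v v i = l *\<^sub>R v i"
    using B(3) vB by blast
  then obtain d where d: "\<And>i. A *v v i = d i *\<^sub>R v i"
    using choice[of "\<lambda>i l. A *v v i = l *\<^sub>R v i"] by blast
  define V :: "real^'n^'n" where "V = (\<chi> i j. v j $ i)"
  have col: "column j V = v j" for j by (simp add: V_def column_def vec_eq_iff)
  have "transpose V ** (A ** V) = diag_mat d"
  proof -
    have "(transpose V ** (A ** V)) $ i $ j = v i \<bullet> (A *v v j)" for i j
      by (simp add: matrix_matrix_mult_def transpose_def V_def inner_vec_def matrix_vector_mult_def)
    then show ?thesis by (simp add: vec_eq_iff diag_mat_def d orth)
  qed
  moreover have "orthogonal_matrix V"
    by (auto simp: orthogonal_matrix_orthonormal_columns col orth norm_eq_1 orthogonal_def)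
  ultimately show ?thesis by (auto simp: matrix_mul_assoc)
qed

section \<open>Positive definite matrices: whitening, inverses and determinants\<close>

definition pos_def :: "real^'n^'n \<Rightarrow> bool" where
  "pos_def A \<longleftrightarrow> transpose A = A \<and> (\<forall>x. x \<noteq> 0 \<longrightarrow> 0 < x \<bullet> (A *v x))"

lemma quadratic_form_congruence:
  fixes A :: "real^'n^'n" and R :: "real^'m^'n"
  shows "(R *v x) \<bullet> (A *v (R *v x)) = x \<bullet> ((transpose R ** A ** R) *v x)"
proof -
  have "(transpose R ** A ** R) *v x = transpose R *v (A *v (R *v x))"
    by (simp only: matrix_vector_mul_assoc matrix_mul_assoc)
  then show ?thesis
    by (simp only: dot_matrix_vector_transpose[of x "transpose R"] transpose_transpose)
qed

lemma pos_def_diagonalization: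
  fixes A :: "real^'n^'n"
  assumes "pos_def A"
  obtains V :: "real^'n^'n" and d where "orthogonal_matrix V" "\<And>i. 0 < d i" "transpose V ** A ** V = diag_mat d"
proof -
  obtain V d where V: "orthogonal_matrix V" and d: "transpose V ** A ** V = diag_mat d"
    using symmetric_matrix_diagonalization assms unfolding pos_def_def by blast
  have "0 < d i" for i
  proof -
    have "norm (column i V) = 1"
      using V by (simp add: orthogonal_matrix_orthonormal_columns)
    then have "V *v axis i 1 \<noteq> 0"
      by (auto simp: matrix_vector_mult_basis)
    then have "0 < (V *v axis i 1) \<bullet> (A *v (V *v axis i 1))"
      using assms by (simp add: pos_def_def)
    also have "\<dots> = axis i 1 \<bullet> (diag_mat d *v axis i 1)"
      by (simp only: quadratic_form_congruence d)
    also have "\<dots> = d i"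
      by (simp add: diag_mat_vector inner_axis')
    finally show ?thesis .
  qed
  with V d that show thesis by blast
qed

text \<open>Scaling each eigenvector by the inverse root of its eigenvalue gives \<open>R\<close>. A
  random vector with covariance \<open>A\<close> is mapped by \<open>transpose R\<close> to one with
  identity covariance.\<close>

lemma pos_def_whitening:
  fixes A :: "real^'n^'n"
  assumes "pos_def A"
  obtains R :: "real^'n^'n" where "transpose R ** A ** R = mat 1"
proof -
  obtain V d where V: "orthogonal_matrix V" and d: "\<And>i. 0 < d i" "transpose V ** A ** V = diag_mat d"
    using pos_def_diagonalization[OF assms] by blast
  define D where "D = diag_mat (\<lambda>i. 1 / sqrt (d i))"
  have "transpose (V ** D) ** A ** (V ** D) = D ** (transpose V ** A ** V) ** D"
    by (simp add: matrix_transpose_mul matrix_mul_assoc D_def)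
  also have "\<dots> = diag_mat (\<lambda>i. d i / (sqrt (d i) * sqrt (d i)))"
    by (simp add: d(2) D_def diag_mat_mult)
  also have "(\<lambda>i. d i / (sqrt (d i) * sqrt (d i))) = (\<lambda>i. 1)"
  proof
    fix i show "d i / (sqrt (d i) * sqrt (d i)) = 1"
      using d(1)[of i] by simp
  qed
  also have "diag_mat (\<lambda>i. 1) = mat 1"
    by simp
  finally show thesis by (rule that)
qed

lemma pos_def_congruence:
  fixes A R :: "real^'n^'n"
  assumes "pos_def A" "invertible R"
  shows "pos_def (transpose R ** A ** R)"
proof -
  have "0 < x \<bullet> ((transpose R ** A ** R) *v x)" if "x \<noteq> 0" for x
  proof -
    have "R *v x \<noteq> 0"
      using inj_matrix_vector_mult[OF assms(2)] that by (metis injD matrix_vector_mult_0_right)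
    then have "0 < (R *v x) \<bullet> (A *v (R *v x))"
      using assms by (simp add: pos_def_def)
    then show ?thesis
      by (simp only: quadratic_form_congruence)
  qed
  then show ?thesis
    using assms(1) by (simp add: pos_def_def matrix_transpose_mul matrix_mul_assoc)
qed

text \<open>\<open>matrix_inv\<close> chooses some two-sided inverse. A one-sided inverse of a
  square matrix is two-sided, and two-sided inverses are unique.\<close>

lemma matrix_inv_eqI:
  fixes A B :: "real^'n^'n"
  assumes "A ** B = mat 1"
  shows "matrix_inv A = B"
proof -
  have BA: "B ** A = mat 1"
    using assms by (simp only: matrix_left_right_inverse)
  have "A ** matrix_inv A = mat 1 \<and> matrix_inv A ** A = mat 1"
    unfolding matrix_inv_def by (rule someI[of _ B]) (simp only: assms BA simp_thms)
  then have "B ** (A ** matrix_inv A) = B"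
    by simp
  then show ?thesis
    by (simp only: matrix_mul_assoc BA matrix_mul_lid)
qed

text \<open>\<open>Q\<close> need not be orthogonal. This serves both the true covariance, with
  \<open>Q = R\<close> and all \<open>e i = 1\<close>, and a fitted one, with
  \<open>Q = R ** V\<close>. Invertibility of \<open>Q\<close> follows from the determinant
  identity, as the product of the \<open>e i\<close> is nonzero.\<close>

lemma congruence_diag_inverse:
  fixes A Q :: "real^'n^'n"
  assumes Q: "transpose Q ** A ** Q = diag_mat e" and e: "\<And>i. 0 < e i"
  shows "matrix_inv A = Q ** diag_mat (\<lambda>i. 1 / e i) ** transpose Q"
    and "det A * (det Q)\<^sup>2 = (\<Prod>i\<in>UNIV. e i)"
    and "invertible Q"
proof -
  have "det A * (det Q)\<^sup>2 = det (transpose Q ** A ** Q)"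
    by (simp only: det_mul det_transpose power2_eq_square mult_ac)
  then show det: "det A * (det Q)\<^sup>2 = (\<Prod>i\<in>UNIV. e i)"
    by (simp only: Q det_diag_mat)
  have "(\<Prod>i\<in>UNIV. e i) > 0" by (simp add: prod_pos e)
  then have "det Q \<noteq> 0"
    unfolding det[symmetric] by auto
  then show inv: "invertible Q" by (simp add: invertible_det_nz)
  then obtain P where P: "P ** Q = mat 1" "Q ** P = mat 1"
    unfolding invertible_def by blast
  have T: "transpose P ** transpose Q = mat 1" 
    using P by (simp add: matrix_transpose_mul[symmetric])
  have e0: "e i \<noteq> 0" for i
    using e[of i] by simp
  have "A ** (Q ** diag_mat (\<lambda>i. 1 / e i) ** transpose Q) =
      (transpose P ** transpose Q) ** A ** (Q ** diag_mat (\<lambda>i. 1 / e i) ** transpose Q)"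
    by (simp add: T)
  also have "\<dots> = transpose P ** ((transpose Q ** A ** Q) ** diag_mat (\<lambda>i. 1 / e i)) ** transpose Q"
    by (simp only: matrix_mul_assoc)
  also have "\<dots> = mat 1"
    by (simp add: Q diag_mat_mult e0 T)
  finally show "matrix_inv A = Q ** diag_mat (\<lambda>i. 1 / e i) ** transpose Q"
    by (rule matrix_inv_eqI)
qed

lemma congruence_diag_quadratic_form:
  fixes A Q :: "real^'n^'n"
  assumes Q: "transpose Q ** A ** Q = diag_mat e" and e: "\<And>i. 0 < e i"
  shows "x \<bullet> (matrix_inv A *v x) = (\<Sum>i\<in>UNIV. ((transpose Q *v x) $ i)\<^sup>2 / e i)"
proof -
  define y where "y = transpose Q *v x"
  have "matrix_inv A *v x = Q *v (diag_mat (\<lambda>i. 1 / e i) *v y)"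
    by (simp only: congruence_diag_inverse(1)[OF Q e] y_def matrix_vector_mul_assoc matrix_mul_assoc)
  then have "x \<bullet> (matrix_inv A *v x) = y \<bullet> (diag_mat (\<lambda>i. 1 / e i) *v y)"
    by (simp only: dot_matrix_vector_transpose[of x] y_def)
  then show ?thesis
    by (simp add: y_def diag_mat_vector inner_vec_def power2_eq_square)
qed

lemma pos_def_det:
  fixes A :: "real^'n^'n"
  assumes "pos_def A"
  shows "0 < det A"
proof -
  obtain V :: "real^'n^'n" and d where d: "\<And>i. 0 < d i" "transpose V ** A ** V = diag_mat d"
    using pos_def_diagonalization[OF assms] by blast
  have "0 < det A * (det V)\<^sup>2"
    unfolding congruence_diag_inverse(2)[OF d(2,1)] using d(1) by (intro prod_pos) auto
  then show ?thesis
    by (simp add: zero_less_mult_iff)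
qed

section \<open>A strong law of large numbers under fourth moments\<close>

lemma (in finite_measure) integrable_power_le4:
  fixes f :: "'a \<Rightarrow> real"
  assumes [measurable]: "f \<in> borel_measurable M" and int: "integrable M (\<lambda>x. f x ^ 4)" and "k \<le> 4"
  shows "integrable M (\<lambda>x. f x ^ k)"
proof (rule Bochner_Integration.integrable_bound[of _ "\<lambda>x. 1 + f x ^ 4"])
  have "\<bar>y ^ k\<bar> \<le> 1 + y ^ 4" for y :: real
  proof (cases "\<bar>y\<bar> \<le> 1")
    case True
    then have "\<bar>y\<bar> ^ k \<le> 1" by (simp add: power_le_one)
    then show ?thesis by (simp add: power_abs add_increasing2)
  next
    case False
    then have "\<bar>y\<bar> ^ k \<le> \<bar>y\<bar> ^ 4" using \<open>k \<le> 4\<close> by (intro power_increasing) auto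
    then show ?thesis by (simp add: power_abs)
  qed
  then show "AE x in M. norm (f x ^ k) \<le> norm (1 + f x ^ 4)"
    by (intro AE_I2) (smt (verit) real_norm_def zero_le_even_power even_numeral)
qed (use int in auto)

lemma (in prob_space) indep_var_power_integral:
  fixes S Z :: "'a \<Rightarrow> real"
  assumes ind: "indep_var borel S borel Z"
    and "integrable M (\<lambda>x. S x ^ j)" "integrable M (\<lambda>x. Z x ^ k)"
  shows "expectation (\<lambda>x. S x ^ j * Z x ^ k) = expectation (\<lambda>x. S x ^ j) * expectation (\<lambda>x. Z x ^ k)"
    and "integrable M (\<lambda>x. S x ^ j * Z x ^ k)"
proof -
  have "indep_var borel ((\<lambda>y. y ^ j) \<circ> S) borel ((\<lambda>y. y ^ k) \<circ> Z)"
    by (rule indep_var_compose[OF ind]) auto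
  then have *: "indep_var borel (\<lambda>x. S x ^ j) borel (\<lambda>x. Z x ^ k)"
    by (simp add: comp_def)
  show "expectation (\<lambda>x. S x ^ j * Z x ^ k) = expectation (\<lambda>x. S x ^ j) * expectation (\<lambda>x. Z x ^ k)"
    by (rule indep_var_lebesgue_integral[OF * assms(2,3)])
  show "integrable M (\<lambda>x. S x ^ j * Z x ^ k)"
    by (rule indep_var_integrable[OF * assms(2,3)])
qed

text \<open>The claims are proved together because expanding \<open>(Z + S) ^ 4\<close> requires the
  mean and second moment of the earlier sum. Independence and centring remove every term in which a
  factor has exponent one; only the cross term with coefficient 6 remains. The second moment of
  \<open>Z\<close> is at most \<open>1 + K\<close> since
  \<open>z\<^sup>2 \<le> 1 + z ^ 4\<close>.\<close>

lemma (in prob_space) partial_sum_fourth_moment: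
  fixes Z :: "nat \<Rightarrow> 'a \<Rightarrow> real"
  assumes ind: "indep_vars (\<lambda>_. borel) Z {1..}"
    and int4: "\<And>i. i \<ge> 1 \<Longrightarrow> integrable M (\<lambda>x. Z i x ^ 4)"
    and mean: "\<And>i. i \<ge> 1 \<Longrightarrow> expectation (Z i) = 0"
    and K: "\<And>i. i \<ge> 1 \<Longrightarrow> expectation (\<lambda>x. Z i x ^ 4) \<le> K"
  defines "S \<equiv> \<lambda>n x. \<Sum>i=1..n. Z i x"
  shows "integrable M (\<lambda>x. S n x ^ 4) \<and> expectation (S n) = 0 \<and>
         expectation (\<lambda>x. S n x ^ 2) \<le> real n * (1 + K) \<and>
         expectation (\<lambda>x. S n x ^ 4) \<le> 6 * (real n * (1 + K))\<^sup>2"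
proof (induction n)
  case 0
  then show ?case by (simp add: S_def)
next
  case (Suc n)
  let ?Z = "Z (Suc n)"
  have rv: "random_variable borel (Z i)" if "i \<ge> 1" for i
    using ind that by (auto simp: indep_vars_def)
  have mZ[measurable]: "?Z \<in> borel_measurable M" by (rule rv) simp
  have mS[measurable]: "S n \<in> borel_measurable M"
    unfolding S_def by (intro borel_measurable_sum rv) simp
  have "0 \<le> expectation (\<lambda>x. Z 1 x ^ 4)" by (intro integral_nonneg_AE) auto
  also have "\<dots> \<le> K" by (rule K) simp
  finally have K0: "0 \<le> K" .
  have "indep_var borel ?Z borel (\<lambda>x. \<Sum>i\<in>{1..n}. Z i x)"
    by (rule indep_vars_sum) (auto intro: indep_vars_subset[OF ind])
  then have indSZ: "indep_var borel ?Z borel (S n)"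
    by (simp add: S_def)
  have intZ: "integrable M (\<lambda>x. ?Z x ^ k)" if "k \<le> 4" for k
    by (rule integrable_power_le4[OF mZ int4 that]) simp
  have intS: "integrable M (\<lambda>x. S n x ^ k)" if "k \<le> 4" for k
    using Suc.IH by (intro integrable_power_le4[OF mS _ that]) simp
  have E: "expectation (\<lambda>x. ?Z x ^ j * S n x ^ k) = expectation (\<lambda>x. ?Z x ^ j) * expectation (\<lambda>x. S n x ^ k)"
    and I: "integrable M (\<lambda>x. ?Z x ^ j * S n x ^ k)" if "j \<le> 4" "k \<le> 4" for j k
    by (rule indep_var_power_integral[OF indSZ intZ[OF that(1)] intS[OF that(2)]])+
  have ZS0: "expectation ?Z = 0" "expectation (S n) = 0"
    using mean[of "Suc n"] Suc.IH by auto
  have S_Suc: "S (Suc n) x = ?Z x + S n x" for x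
    by (simp add: S_def add.commute)
  \<comment> \<open>The zeroth and first powers are kept explicit so that the product rules
    \<open>E\<close> and \<open>I\<close> apply to every summand in the same form.\<close>
  have p2: "S (Suc n) x ^ 2 = ?Z x ^ 2 * S n x ^ 0 + 2 * (?Z x ^ 1 * S n x ^ 1) + ?Z x ^ 0 * S n x ^ 2" for x
    by (simp add: S_Suc power2_sum)
  have p4: "S (Suc n) x ^ 4 = ?Z x ^ 4 * S n x ^ 0 + 4 * (?Z x ^ 3 * S n x ^ 1)
      + 6 * (?Z x ^ 2 * S n x ^ 2) + 4 * (?Z x ^ 1 * S n x ^ 3) + ?Z x ^ 0 * S n x ^ 4" for x
  proof -
    have "(a + b) ^ 4 = a ^ 4 + 4 * (a ^ 3 * b) + 6 * (a ^ 2 * b ^ 2) + 4 * (a * b ^ 3) + b ^ 4"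
      for a b :: real by algebra
    then show ?thesis by (simp add: S_Suc)
  qed
  have i4: "integrable M (\<lambda>x. S (Suc n) x ^ 4)"
    unfolding p4 by (intro Bochner_Integration.integrable_add integrable_mult_right I) auto
  have e1: "expectation (S (Suc n)) = 0"
    unfolding S_Suc using intZ[of 1] intS[of 1] ZS0 by simp
  have e2: "expectation (\<lambda>x. S (Suc n) x ^ 2) = expectation (\<lambda>x. ?Z x ^ 2) + expectation (\<lambda>x. S n x ^ 2)"
  proof -
    have "expectation (\<lambda>x. S (Suc n) x ^ 2) = expectation (\<lambda>x. ?Z x ^ 2 * S n x ^ 0)
      + 2 * expectation (\<lambda>x. ?Z x ^ 1 * S n x ^ 1) + expectation (\<lambda>x. ?Z x ^ 0 * S n x ^ 2)"
      unfolding p2 using I[of 2 0] I[of 1 1] I[of 0 2] by (simp del: power_0 power_one_right)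
    then show ?thesis
      using ZS0 by (simp add: E[of 1 1, simplified])
  qed
  have e4: "expectation (\<lambda>x. S (Suc n) x ^ 4) = expectation (\<lambda>x. ?Z x ^ 4) +
     6 * (expectation (\<lambda>x. ?Z x ^ 2) * expectation (\<lambda>x. S n x ^ 2)) + expectation (\<lambda>x. S n x ^ 4)"
  proof -
    have "expectation (\<lambda>x. S (Suc n) x ^ 4) = expectation (\<lambda>x. ?Z x ^ 4 * S n x ^ 0)
      + 4 * expectation (\<lambda>x. ?Z x ^ 3 * S n x ^ 1) + 6 * expectation (\<lambda>x. ?Z x ^ 2 * S n x ^ 2)
      + 4 * expectation (\<lambda>x. ?Z x ^ 1 * S n x ^ 3) + expectation (\<lambda>x. ?Z x ^ 0 * S n x ^ 4)"
      unfolding p4 using I[of 4 0] I[of 3 1] I[of 2 2] I[of 1 3] I[of 0 4]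
      by (simp del: power_0 power_one_right)
    then show ?thesis
      using ZS0 by (simp add: E[of 3 1, simplified] E[of 1 3, simplified] E[of 2 2])
  qed
  have z4: "expectation (\<lambda>x. ?Z x ^ 4) \<le> K" by (rule K) simp
  have "expectation (\<lambda>x. ?Z x ^ 2) \<le> expectation (\<lambda>x. 1 + ?Z x ^ 4)"
  proof (rule integral_mono)
    fix x
    have "0 \<le> (?Z x ^ 2 - 1 / 2)\<^sup>2" by simp
    then show "?Z x ^ 2 \<le> 1 + ?Z x ^ 4"
      by (simp add: power2_diff power_divide flip: power_mult)
  qed (use intZ[of 2] intZ[of 4] in auto)
  also have "\<dots> = 1 + expectation (\<lambda>x. ?Z x ^ 4)"
    using intZ[of 4] by (simp add: prob_space)
  finally have z2: "expectation (\<lambda>x. ?Z x ^ 2) \<le> 1 + K" using z4 by linarith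
  have z20: "0 \<le> expectation (\<lambda>x. ?Z x ^ 2)" "0 \<le> expectation (\<lambda>x. S n x ^ 2)"
    by (intro integral_nonneg_AE; simp)+
  have b2: "expectation (\<lambda>x. S n x ^ 2) \<le> real n * (1 + K)"
    and b4: "expectation (\<lambda>x. S n x ^ 4) \<le> 6 * (real n * (1 + K))\<^sup>2"
    using Suc.IH by auto
  have "expectation (\<lambda>x. ?Z x ^ 2) * expectation (\<lambda>x. S n x ^ 2) \<le> (1 + K) * (real n * (1 + K))"
    using z2 b2 z20 K0 by (intro mult_mono) auto
  moreover have "K \<le> (1 + K)\<^sup>2"
    using K0 by (simp add: power2_sum)
  ultimately have "expectation (\<lambda>x. S (Suc n) x ^ 4) \<le>
      (1 + K)\<^sup>2 + 6 * ((1 + K) * (real n * (1 + K))) + 6 * (real n * (1 + K))\<^sup>2"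
    unfolding e4 using z4 b4 by linarith
  also have "\<dots> = (1 + 6 * real n + 6 * (real n)\<^sup>2) * (1 + K)\<^sup>2"
    by (simp add: power2_eq_square algebra_simps)
  also have "\<dots> \<le> (6 * (real (Suc n))\<^sup>2) * (1 + K)\<^sup>2"
    by (intro mult_right_mono zero_le_power2) (simp add: power2_eq_square algebra_simps)
  also have "\<dots> = 6 * (real (Suc n) * (1 + K))\<^sup>2"
    by (simp only: power_mult_distrib mult.assoc)
  finally have r4: "expectation (\<lambda>x. S (Suc n) x ^ 4) \<le> 6 * (real (Suc n) * (1 + K))\<^sup>2" .
  have "expectation (\<lambda>x. S (Suc n) x ^ 2) \<le> real (Suc n) * (1 + K)"
    unfolding e2 using z2 b2 by (simp add: algebra_simps)
  with i4 e1 r4 show ?case by blast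
qed

text \<open>The fourth moment of the average is of order \<open>1 / n ^ 2\<close>, which is
  summable. Hence the series of fourth powers has finite expectation, converges almost surely, and
  its terms tend to 0.\<close>

theorem (in prob_space) strong_law_fourth_moment:
  fixes Z :: "nat \<Rightarrow> 'a \<Rightarrow> real"
  assumes ind: "indep_vars (\<lambda>_. borel) Z {1..}"
    and int4: "\<And>i. i \<ge> 1 \<Longrightarrow> integrable M (\<lambda>x. Z i x ^ 4)"
    and mean: "\<And>i. i \<ge> 1 \<Longrightarrow> expectation (Z i) = 0"
    and K: "\<And>i. i \<ge> 1 \<Longrightarrow> expectation (\<lambda>x. Z i x ^ 4) \<le> K"
  shows "AE x in M. (\<lambda>n. (\<Sum>i=1..n. Z i x) / real n) \<longlonglongrightarrow> 0"
proof -
  define S where "S = (\<lambda>n x. \<Sum>i=1..n. Z i x)"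
  have int: "integrable M (\<lambda>x. S n x ^ 4)"
    and moment: "expectation (\<lambda>x. S n x ^ 4) \<le> 6 * (real n * (1 + K))\<^sup>2" for n
    unfolding S_def using partial_sum_fourth_moment[OF assms, of n] by simp_all
  have mS[measurable]: "S n \<in> borel_measurable M" for n
    unfolding S_def using ind by (intro borel_measurable_sum) (auto simp: indep_vars_def)
  define C where "C = 6 * (1 + K)\<^sup>2"
  have C0: "0 \<le> C" by (simp add: C_def)
  \<comment> \<open>At \<open>n = 0\<close> both sides are 0, because division by zero yields
    0.\<close>
  have nn: "(\<integral>\<^sup>+x. ennreal ((S n x / real n) ^ 4) \<partial>M) \<le> ennreal (C * (1 / real n ^ 2))" for n
  proof (cases "n = 0")
    case False
    have "(\<integral>\<^sup>+x. ennreal ((S n x / real n) ^ 4) \<partial>M) = ennreal (expectation (\<lambda>x. (S n x / real n) ^ 4))"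
      using int[of n] by (intro nn_integral_eq_integral) (simp_all add: power_divide)
    also have "expectation (\<lambda>x. (S n x / real n) ^ 4) = expectation (\<lambda>x. S n x ^ 4) / real n ^ 4"
      by (simp add: power_divide)
    also have "\<dots> \<le> 6 * (real n * (1 + K))\<^sup>2 / real n ^ 4"
      using moment[of n] by (intro divide_right_mono) auto
    also have "\<dots> = C * (1 / real n ^ 2)"
      using False by (simp add: C_def power_mult_distrib power4_eq_xxxx power2_eq_square)
    finally show ?thesis by (simp add: ennreal_leI)
  qed simp
  have sm: "summable (\<lambda>n. C * (1 / real n ^ 2))"
    using inverse_power_summable[of 2, where 'a = real]
    by (intro summable_mult) (simp add: inverse_eq_divide)
  have "(\<integral>\<^sup>+x. (\<Sum>n. ennreal ((S n x / real n) ^ 4)) \<partial>M) = (\<Sum>n. \<integral>\<^sup>+x. ennreal ((S n x / real n) ^ 4) \<partial>M)"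
    by (intro nn_integral_suminf) auto
  also have "\<dots> \<le> (\<Sum>n. ennreal (C * (1 / real n ^ 2)))"
    by (intro suminf_le nn) auto
  also have "\<dots> = ennreal (\<Sum>n. C * (1 / real n ^ 2))"
    using C0 sm by (intro suminf_ennreal2) auto
  finally have "(\<integral>\<^sup>+x. (\<Sum>n. ennreal ((S n x / real n) ^ 4)) \<partial>M) \<noteq> \<infinity>"
    by (auto simp: top_unique)
  then have "AE x in M. (\<Sum>n. ennreal ((S n x / real n) ^ 4)) \<noteq> \<infinity>"
    by (intro nn_integral_PInf_AE) auto
  then show ?thesis
  proof eventually_elim
    case (elim x)
    then have "summable (\<lambda>n. (S n x / real n) ^ 4)"
      by (intro summable_suminf_not_top) auto
    then have "(\<lambda>n. (S n x / real n) ^ 4) \<longlonglongrightarrow> 0"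
      by (rule summable_LIMSEQ_zero)
    then have "(\<lambda>n. root 4 ((S n x / real n) ^ 4)) \<longlonglongrightarrow> root 4 0"
      by (intro tendsto_real_root)
    moreover have "root 4 (y ^ 4) = \<bar>y\<bar>" for y :: real
      using real_root_power_cancel[of 4 "\<bar>y\<bar>"] power_even_abs[of 4 y] by simp
    ultimately have "(\<lambda>n. \<bar>S n x / real n\<bar>) \<longlonglongrightarrow> 0"
      by (simp only: real_root_zero)
    then show ?case
      unfolding S_def by (rule tendsto_rabs_zero_cancel)
  qed
qed

section \<open>Moments of the multivariate normal distribution\<close>

lemma mvn_density_pos:
  assumes "0 < det S"
  shows "0 < mvn_density m S x"
  using assms by (simp add: mvn_density_def)

text \<open>
  Completing the square turns the exponentially tilted density into a translate of the density,
  so the moment generating function follows from translation invariance of Lebesgue measure alone,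
  without evaluating the normalising constant.
\<close>

lemma (in prob_space) mvn_moment_generating_function:
  fixes X :: "'a \<Rightarrow> real^'n" and S :: "real^'n^'n"
  assumes pd: "pos_def S"
    and D: "distributed M lborel X (\<lambda>x. ennreal (mvn_density 0 S x))"
  shows "integrable M (\<lambda>w. exp (u \<bullet> X w))"
    and "expectation (\<lambda>w. exp (u \<bullet> X w)) = exp (u \<bullet> (S *v u) / 2)"
proof -
  note [measurable] = distributed_measurable[OF D, simplified]
  have S: "transpose S = S" "invertible S"
    using pd pos_def_det[OF pd] by (auto simp: pos_def_def invertible_det_nz)
  define f where "f = mvn_density 0 S"
  define P where "P = matrix_inv S"
  obtain Q where Q: "S ** Q = mat 1" "Q ** S = mat 1"
    using S(2) unfolding invertible_def by blast
  have PQ: "P = Q"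
    unfolding P_def by (rule matrix_inv_eqI[OF Q(1)])
  have "transpose Q ** S = mat 1"
    using arg_cong[OF Q(1), of transpose] by (simp only: matrix_transpose_mul S(1) transpose_mat)
  then have "transpose Q ** (S ** Q) = Q"
    by (simp only: matrix_mul_assoc matrix_mul_lid)
  then have symP: "transpose P = P"
    by (simp only: Q(1) matrix_mul_rid PQ)
  define v where "v = S *v u"
  have Pv: "P *v v = u"
    by (simp only: v_def PQ matrix_vector_mul_assoc Q matrix_vector_mul_lid)
  have fpos: "0 \<le> f x" for x
    unfolding f_def by (intro less_imp_le mvn_density_pos pos_def_det[OF pd])
  have tilt: "exp (u \<bullet> x) * f x = exp (u \<bullet> v / 2) * f (x - v)" for x
  proof -
    have "x \<bullet> (P *v v) = u \<bullet> x"
      by (simp only: Pv inner_commute)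
    moreover have "v \<bullet> (P *v x) = u \<bullet> x"
      using dot_matrix_vector_transpose[of v P x] by (simp only: symP Pv)
    ultimately have "(x - v) \<bullet> (P *v (x - v)) = x \<bullet> (P *v x) - 2 * (u \<bullet> x) + u \<bullet> v"
      by (simp add: matrix_vector_mult_diff_distrib inner_diff_left inner_diff_right Pv inner_commute[of v u])
    then have "u \<bullet> v / 2 + - ((x - v) \<bullet> (P *v (x - v))) / 2 = u \<bullet> x + - (x \<bullet> (P *v x)) / 2"
      by (simp add: field_simps)
    then show ?thesis
      unfolding f_def mvn_density_def P_def[symmetric]
      by (simp only: diff_zero times_divide_eq_right exp_add[symmetric])
  qed
  have [measurable]: "f \<in> borel_measurable borel"
    using distributed_borel_measurable[OF D] fpos by (simp add: f_def)
  \<comment> \<open>The total mass is known because \<open>f\<close> is the density of a random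
    variable under a probability measure.\<close>
  have one: "(\<integral>\<^sup>+x. ennreal (f x) \<partial>lborel) = 1"
    using distributed_nn_integral[OF D, of "\<lambda>_. 1"] by (simp add: f_def emeasure_space_1)
  have shift: "(\<integral>\<^sup>+x. ennreal (f (x - v)) \<partial>lborel) = (\<integral>\<^sup>+x. ennreal (f x) \<partial>lborel)"
  proof -
    have "(\<integral>\<^sup>+x. ennreal (f (x - v)) \<partial>lborel) = (\<integral>\<^sup>+x. ennreal (f (x - v)) \<partial>distr lborel borel ((+) v))"
      by (simp only: lborel_distr_plus)
    also have "\<dots> = (\<integral>\<^sup>+x. ennreal (f x) \<partial>lborel)"
      by (subst nn_integral_distr) auto
    finally show ?thesis .
  qed
  have "(\<integral>\<^sup>+w. ennreal (exp (u \<bullet> X w)) \<partial>M) = (\<integral>\<^sup>+x. ennreal (f x) * ennreal (exp (u \<bullet> x)) \<partial>lborel)"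
    unfolding f_def by (rule distributed_nn_integral[OF D, symmetric]) simp
  also have "\<dots> = (\<integral>\<^sup>+x. ennreal (exp (u \<bullet> v / 2)) * ennreal (f (x - v)) \<partial>lborel)"
    by (simp only: ennreal_mult[symmetric] mult.commute[of "f _"] tilt exp_ge_zero fpos)
  also have "\<dots> = ennreal (exp (u \<bullet> v / 2))"
    by (subst nn_integral_cmult) (simp_all add: shift one)
  finally have *: "(\<integral>\<^sup>+w. ennreal (exp (u \<bullet> X w)) \<partial>M) = ennreal (exp (u \<bullet> (S *v u) / 2))"
    by (simp only: v_def)
  show "integrable M (\<lambda>w. exp (u \<bullet> X w))"
    by (rule integrableI_nn_integral_finite[OF _ _ *]) simp_all
  show "expectation (\<lambda>w. exp (u \<bullet> X w)) = exp (u \<bullet> (S *v u) / 2)"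
    by (subst integral_eq_nn_integral) (simp_all add: *)
qed

section \<open>Estimates for second differences of the exponential\<close>

lemma abs_le_abs_sinh: "\<bar>x\<bar> \<le> \<bar>sinh x\<bar>" for x :: real
proof -
  have *: "y \<le> sinh y" if "0 \<le> y" for y :: real
  proof -
    have "(\<lambda>y. sinh y - y) 0 \<le> (\<lambda>y. sinh y - y) y"
    proof (rule DERIV_nonneg_imp_nondecreasing[OF that])
      fix z :: real assume "0 \<le> z"
      then show "\<exists>d. ((\<lambda>y. sinh y - y) has_real_derivative d) (at z) \<and> 0 \<le> d"
        by (intro exI[of _ "cosh z - 1"]) (auto intro!: derivative_eq_intros simp: cosh_real_ge_1)
    qed
    then show ?thesis by simp
  qed
  show ?thesis using *[of x] *[of "-x"] by (cases "0 \<le> x") auto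
qed

lemma abs_sinh_le: "\<bar>sinh x\<bar> \<le> \<bar>x\<bar> * cosh x" for x :: real
proof -
  have *: "sinh y \<le> y * cosh y" if "0 \<le> y" for y :: real
  proof -
    have "(\<lambda>y. y * cosh y - sinh y) 0 \<le> (\<lambda>y. y * cosh y - sinh y) y"
    proof (rule DERIV_nonneg_imp_nondecreasing[OF that])
      fix z :: real assume "0 \<le> z"
      then show "\<exists>d. ((\<lambda>y. y * cosh y - sinh y) has_real_derivative d) (at z) \<and> 0 \<le> d"
        by (intro exI[of _ "z * sinh z"]) (auto intro!: derivative_eq_intros simp: cosh_real_ge_1)
    qed
    then show ?thesis by simp
  qed
  show ?thesis using *[of x] *[of "-x"] by (cases "0 \<le> x") auto
qed

text \<open>Being a square of a hyperbolic sine, the second difference inherits upper and lower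
  bounds from those on \<open>sinh\<close>.\<close>

lemma exp_plus_exp_minus: "exp x + exp (- x) - 2 = 4 * (sinh (x / 2))\<^sup>2" for x :: real
proof -
  have "exp x = exp (x / 2) * exp (x / 2)" "exp (- x) = exp (- (x / 2)) * exp (- (x / 2))"
    by (simp_all flip: exp_add)
  moreover have "exp (x / 2) * exp (- (x / 2)) = 1"
    by (simp flip: exp_add)
  ultimately show ?thesis
    by (simp add: sinh_def power2_eq_square field_simps)
qed

text \<open>Applied to \<open>t * y\<close> and divided by \<open>t\<^sup>2\<close>, this leads to a
  dominating function for difference quotients that is uniform in small \<open>t\<close>.\<close>

lemma second_difference_exp_le: "exp x + exp (- x) - 2 \<le> x\<^sup>2 * (exp x + exp (- x))" for x :: real
proof -
  have "(sinh (x / 2))\<^sup>2 \<le> (\<bar>x / 2\<bar> * cosh (x / 2))\<^sup>2"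
    using abs_sinh_le[of "x / 2"] by (subst power2_abs[symmetric]) (intro power_mono; simp)
  also have "\<dots> = x\<^sup>2 / 4 * (cosh (x / 2))\<^sup>2"
    by (simp add: power_mult_distrib power_divide)
  finally have "4 * (sinh (x / 2))\<^sup>2 \<le> x\<^sup>2 * (cosh (x / 2))\<^sup>2" by simp
  also have "(cosh (x / 2))\<^sup>2 = (sinh (x / 2))\<^sup>2 + 1" by (simp add: cosh_square_eq)
  also have "\<dots> = (exp x + exp (- x) + 2) / 4"
    using exp_plus_exp_minus[of x] by simp
  also have "x\<^sup>2 * ((exp x + exp (- x) + 2) / 4) \<le> x\<^sup>2 * (exp x + exp (- x))"
  proof (rule mult_left_mono)
    show "(exp x + exp (- x) + 2) / 4 \<le> exp x + exp (- x)"
    proof -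
      have "0 \<le> exp x + exp (- x) - 2"
        unfolding exp_plus_exp_minus by simp
      then show ?thesis by simp
    qed
  qed simp
  finally show ?thesis by (simp only: exp_plus_exp_minus)
qed

lemma power2_le_second_difference_exp: "x\<^sup>2 \<le> exp x + exp (- x) - 2" for x :: real
proof -
  have "\<bar>x / 2\<bar>\<^sup>2 \<le> \<bar>sinh (x / 2)\<bar>\<^sup>2"
    using abs_le_abs_sinh[of "x / 2"] by (intro power_mono) auto
  then have "x\<^sup>2 \<le> 4 * (sinh (x / 2))\<^sup>2"
    by (simp add: power_divide)
  then show ?thesis using exp_plus_exp_minus[of x] by linarith
qed


lemma exp_mult_le: "exp (t * x) \<le> exp x + exp (- x)" if "\<bar>t\<bar> \<le> 1" for t x :: real
proof -
  have "t * x \<le> \<bar>x\<bar>"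
    using mult_right_mono[OF that abs_ge_zero[of x]] by (simp add: abs_mult[symmetric])
  then have "exp (t * x) \<le> exp \<bar>x\<bar>" by simp
  also have "\<dots> \<le> exp x + exp (- x)" by (simp add: abs_if)
  finally show ?thesis .
qed

text \<open>The fourth power of \<open>(x / 4)\<^sup>2 \<le> 2 * exp \<bar>x / 4\<bar>\<close> has
  exponent \<open>\<bar>x\<bar>\<close> on the right; the constant is
  \<open>4 ^ 8 * 2 ^ 4 = 2 ^ 20\<close>.\<close>

lemma power8_le_exp: "x ^ 8 \<le> 2 ^ 20 * (exp x + exp (- x))" for x :: real
proof -
  have "(x / 4)\<^sup>2 \<le> exp (x / 4) + exp (- (x / 4)) - 2"
    by (rule power2_le_second_difference_exp)
  also have "\<dots> \<le> 2 * exp \<bar>x / 4\<bar>"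
    using exp_le_cancel_iff[of "x / 4" "\<bar>x / 4\<bar>"] exp_le_cancel_iff[of "- (x / 4)" "\<bar>x / 4\<bar>"]
    by linarith
  finally have "((x / 4)\<^sup>2) ^ 4 \<le> (2 * exp \<bar>x / 4\<bar>) ^ 4"
    by (intro power_mono) auto
  also have "\<dots> = 16 * exp \<bar>x\<bar>"
    by (simp add: power_mult_distrib flip: exp_of_nat_mult)
  also have "\<dots> \<le> 16 * (exp x + exp (- x))"
    by (simp add: abs_if)
  finally show ?thesis
    by (simp add: power_divide flip: power_mult)
qed

text \<open>\<open>Y\<^sup>2\<close> is the limit of
  \<open>(exp (t * Y) + exp (- t * Y) - 2) / t\<^sup>2\<close> as \<open>t\<close> tends to 0.
  Dominated convergence moves this limit through the expectation, where the quotient is explicit in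
  \<open>s\<close>; no differentiation under the integral is involved.\<close>

lemma (in prob_space) moments_of_gaussian_mgf:
  fixes Y :: "'a \<Rightarrow> real"
  assumes [measurable]: "Y \<in> borel_measurable M"
    and int: "\<And>t. integrable M (\<lambda>w. exp (t * Y w))"
    and mgf: "\<And>t. expectation (\<lambda>w. exp (t * Y w)) = exp (t\<^sup>2 * s / 2)"
  shows "integrable M (\<lambda>w. Y w ^ 8)" "integrable M (\<lambda>w. Y w ^ 2)" "expectation (\<lambda>w. Y w ^ 2) = s"
proof -
  have int': "integrable M (\<lambda>w. exp (- (t * Y w)))" for t
    using int[of "- t"] by simp
  show "integrable M (\<lambda>w. Y w ^ 8)"
  proof (rule Bochner_Integration.integrable_bound)
    show "integrable M (\<lambda>w. 2 ^ 20 * (exp (Y w) + exp (- Y w)))"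
      using int[of 1] int'[of 1] by simp
    show "AE w in M. norm (Y w ^ 8) \<le> norm (2 ^ 20 * (exp (Y w) + exp (- Y w)))"
      using power8_le_exp by (intro AE_I2) (simp add: abs_mult power_even_abs)
  qed simp
  define t where "t = (\<lambda>n. 1 / (real n + 1))"
  have t: "0 < t n" "\<bar>t n\<bar> \<le> 1" for n by (auto simp: t_def)
  have t0: "t \<longlonglongrightarrow> 0"
    using LIMSEQ_inverse_real_of_nat by (simp add: t_def inverse_eq_divide add.commute)
  define g where "g = (\<lambda>n y. (exp (t n * y) + exp (- (t n * y)) - 2) / (t n)\<^sup>2)"
  have g_lower: "y\<^sup>2 \<le> g n y" for n y
    using power2_le_second_difference_exp[of "t n * y"] t(1)[of n]
    by (simp add: g_def field_simps power_mult_distrib)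
  have g_upper: "g n y \<le> y\<^sup>2 * (cosh (t n * y / 2))\<^sup>2" for n y
  proof -
    have "(sinh (t n * y / 2))\<^sup>2 \<le> (\<bar>t n * y / 2\<bar> * cosh (t n * y / 2))\<^sup>2"
      using abs_sinh_le[of "t n * y / 2"] by (subst power2_abs[symmetric]) (intro power_mono; simp)
    then have "4 * (sinh (t n * y / 2))\<^sup>2 \<le> (t n)\<^sup>2 * (y\<^sup>2 * (cosh (t n * y / 2))\<^sup>2)"
      by (simp add: power_mult_distrib power_divide mult_ac)
    then show ?thesis
      using t(1)[of n] by (simp add: g_def exp_plus_exp_minus field_simps)
  qed
  have g_lim: "(\<lambda>n. g n y) \<longlonglongrightarrow> y\<^sup>2" for y
  proof (rule tendsto_sandwich[OF _ _ tendsto_const])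
    have "(\<lambda>n. y\<^sup>2 * (cosh (t n * y / 2))\<^sup>2) \<longlonglongrightarrow> y\<^sup>2 * (cosh (0 * y / 2))\<^sup>2"
      by (intro tendsto_intros t0) auto
    then show "(\<lambda>n. y\<^sup>2 * (cosh (t n * y / 2))\<^sup>2) \<longlonglongrightarrow> y\<^sup>2" by simp
  qed (simp_all add: g_lower g_upper)
  \<comment> \<open>This is \<open>(exp y + exp (- y)) * (2 * (exp y + exp (- y)))\<close>
    multiplied out: the first factor bounds \<open>y\<^sup>2\<close>, the second bounds
    \<open>exp (t * y) + exp (- t * y)\<close> for \<open>\<bar>t\<bar> \<le> 1\<close>.\<close>
  define B where "B = (\<lambda>y::real. 2 * (exp (2 * y) + exp (- (2 * y)) + 2))"
  have g_bound: "\<bar>g n y\<bar> \<le> B y" for n y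
  proof -
    have 1: "exp (t n * y) + exp (- (t n * y)) \<le> 2 * (exp y + exp (- y))"
      using exp_mult_le[of "t n" y] exp_mult_le[of "- t n" y] t(2)[of n] by simp
    have 2: "y\<^sup>2 \<le> exp y + exp (- y)"
      using power2_le_second_difference_exp[of y] by simp
    have "g n y \<le> y\<^sup>2 * (exp (t n * y) + exp (- (t n * y)))"
      using second_difference_exp_le[of "t n * y"] t(1)[of n]
      by (simp add: g_def field_simps power_mult_distrib)
    also have "\<dots> \<le> (exp y + exp (- y)) * (2 * (exp y + exp (- y)))"
      by (rule mult_mono[OF 2 1]) (simp_all add: add_nonneg_nonneg)
    also have "\<dots> = B y"
    proof -
      have "exp y * exp (- y) = 1" "exp (2 * y) = exp y * exp y" "exp (- (2 * y)) = exp (- y) * exp (- y)"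
        by (simp_all flip: exp_add)
      then show ?thesis by (simp add: B_def algebra_simps)
    qed
    finally show ?thesis
      using g_lower[of y n] zero_le_power2[of y] by linarith
  qed
  have intB: "integrable M (\<lambda>w. B (Y w))"
    unfolding B_def by (intro integrable_mult_right Bochner_Integration.integrable_add int int' integrable_const)
  have [measurable]: "g n \<in> borel_measurable borel" for n
    unfolding g_def by measurable
  have lim: "(\<lambda>n. expectation (\<lambda>w. g n (Y w))) \<longlonglongrightarrow> expectation (\<lambda>w. Y w ^ 2)"
    by (rule integral_dominated_convergence[OF _ _ intB]) (auto simp: g_lim g_bound)
  show "integrable M (\<lambda>w. Y w ^ 2)"
    by (rule integrable_dominated_convergence[OF _ _ intB, of _ "\<lambda>n w. g n (Y w)"]) (auto simp: g_lim g_bound)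
  have E: "expectation (\<lambda>w. g n (Y w)) = 2 * (exp ((t n)\<^sup>2 * s / 2) - 1) / (t n)\<^sup>2" for n
    using int[of "t n"] int'[of "t n"] mgf[of "t n"] mgf[of "- t n"]
    by (simp add: g_def prob_space)
  have "(\<lambda>n. expectation (\<lambda>w. g n (Y w))) \<longlonglongrightarrow> s"
  proof (rule tendsto_sandwich[OF _ _ tendsto_const])
    have "(\<lambda>n. s * exp ((t n)\<^sup>2 * s / 2)) \<longlonglongrightarrow> s * exp (0\<^sup>2 * s / 2)"
      by (intro tendsto_intros t0) auto
    then show "(\<lambda>n. s * exp ((t n)\<^sup>2 * s / 2)) \<longlonglongrightarrow> s" by simp
    have "s \<le> 2 * (exp ((t n)\<^sup>2 * s / 2) - 1) / (t n)\<^sup>2" for n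
      using exp_ge_add_one_self[of "(t n)\<^sup>2 * s / 2"] t(1)[of n] by (simp add: field_simps)
    then show "\<forall>\<^sub>F n in sequentially. s \<le> expectation (\<lambda>w. g n (Y w))"
      by (simp add: E)
    \<comment> \<open>Upper half of the sandwich: multiplying \<open>1 - h \<le> exp (- h)\<close>
      by \<open>exp h\<close> gives \<open>exp h - 1 \<le> h * exp h\<close>.\<close>
    have "2 * (exp ((t n)\<^sup>2 * s / 2) - 1) / (t n)\<^sup>2 \<le> s * exp ((t n)\<^sup>2 * s / 2)" for n
    proof -
      define h where "h = (t n)\<^sup>2 * s / 2"
      have "1 - h \<le> exp (- h)" using exp_ge_add_one_self[of "- h"] by simp
      then have "(1 - h) * exp h \<le> exp (- h) * exp h" by (intro mult_right_mono) auto
      then have "exp h - 1 \<le> h * exp h" by (simp add: algebra_simps flip: exp_add)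
      then show ?thesis
        unfolding h_def[symmetric] using t(1)[of n] by (simp add: field_simps h_def)
    qed
    then show "\<forall>\<^sub>F n in sequentially. expectation (\<lambda>w. g n (Y w)) \<le> s * exp ((t n)\<^sup>2 * s / 2)"
      by (simp add: E)
  qed
  with lim show "expectation (\<lambda>w. Y w ^ 2) = s"
    by (rule LIMSEQ_unique)
qed

lemma (in prob_space) mvn_linear_form_moments:
  fixes X :: "'a \<Rightarrow> real^'n" and S :: "real^'n^'n"
  assumes pd: "pos_def S"
    and D: "distributed M lborel X (\<lambda>x. ennreal (mvn_density 0 S x))"
  shows "integrable M (\<lambda>w. (u \<bullet> X w) ^ 8)" "integrable M (\<lambda>w. (u \<bullet> X w)\<^sup>2)"
    and "expectation (\<lambda>w. (u \<bullet> X w)\<^sup>2) = u \<bullet> (S *v u)"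
proof -
  note [measurable] = distributed_measurable[OF D, simplified]
  have 1: "(\<lambda>w. u \<bullet> X w) \<in> borel_measurable M" by measurable
  have 2: "integrable M (\<lambda>w. exp (t * (u \<bullet> X w)))" for t
    using mvn_moment_generating_function(1)[OF pd D, of "t *\<^sub>R u"] by simp
  have 3: "expectation (\<lambda>w. exp (t * (u \<bullet> X w))) = exp (t\<^sup>2 * (u \<bullet> (S *v u)) / 2)" for t
    using mvn_moment_generating_function(2)[OF pd D, of "t *\<^sub>R u"]
    by (simp add: matrix_vector_mult_scaleR power2_eq_square mult.assoc)
  note * = moments_of_gaussian_mgf[OF 1 2 3]
  show "integrable M (\<lambda>w. (u \<bullet> X w) ^ 8)" "integrable M (\<lambda>w. (u \<bullet> X w)\<^sup>2)"
    "expectation (\<lambda>w. (u \<bullet> X w)\<^sup>2) = u \<bullet> (S *v u)"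
    by (fact *)+
qed

text \<open>Polarization reduces products of two linear forms to squares of single ones, and
  symmetry of \<open>S\<close> identifies the two cross terms. The last claim supplies the fourth
  moments required by the strong law.\<close>

lemma (in prob_space) mvn_mixed_moments:
  fixes X :: "'a \<Rightarrow> real^'n" and S :: "real^'n^'n"
  assumes pd: "pos_def S"
    and D: "distributed M lborel X (\<lambda>x. ennreal (mvn_density 0 S x))"
  shows "integrable M (\<lambda>w. (u \<bullet> X w) * (v \<bullet> X w))"
    and "expectation (\<lambda>w. (u \<bullet> X w) * (v \<bullet> X w)) = u \<bullet> (S *v v)"
    and "integrable M (\<lambda>w. ((u \<bullet> X w) * (v \<bullet> X w) - c) ^ 4)"
proof -
  note [measurable] = distributed_measurable[OF D, simplified]
  note m = mvn_linear_form_moments[OF pd D]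
  have polar: "(u \<bullet> X w) * (v \<bullet> X w) = (((u + v) \<bullet> X w)\<^sup>2 - ((u - v) \<bullet> X w)\<^sup>2) / 4" for w
    by (simp add: inner_add_left inner_diff_left power2_eq_square algebra_simps)
  show "integrable M (\<lambda>w. (u \<bullet> X w) * (v \<bullet> X w))"
    unfolding polar by (intro integrable_divide Bochner_Integration.integrable_diff m(2))
  have "v \<bullet> (S *v u) = u \<bullet> (S *v v)"
    using dot_matrix_vector_transpose[of v S u] pd by (simp only: pos_def_def inner_commute)
  then have "((u + v) \<bullet> (S *v (u + v)) - (u - v) \<bullet> (S *v (u - v))) / 4 = u \<bullet> (S *v v)"
    by (simp add: inner_add_left inner_diff_left inner_add_right inner_diff_right
        matrix_vector_right_distrib matrix_vector_mult_diff_distrib)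
  then show "expectation (\<lambda>w. (u \<bullet> X w) * (v \<bullet> X w)) = u \<bullet> (S *v v)"
    unfolding polar using m(2)[of "u + v"] m(2)[of "u - v"] by (simp add: m(3))
  show "integrable M (\<lambda>w. ((u \<bullet> X w) * (v \<bullet> X w) - c) ^ 4)"
  proof (rule Bochner_Integration.integrable_bound)
    show "integrable M (\<lambda>w. 8 * ((u \<bullet> X w) ^ 8 + (v \<bullet> X w) ^ 8 + c ^ 4))"
      by (intro integrable_mult_right Bochner_Integration.integrable_add m(1) integrable_const)
    \<comment> \<open>Two applications of
      \<open>(p \<plusminus> q)\<^sup>2 \<le> 2 * (p\<^sup>2 + q\<^sup>2)\<close> produce the
      constant \<open>2\<^sup>2 * 2 = 8\<close>.\<close>
    have "(x * y - c) ^ 4 \<le> 8 * (x ^ 8 + y ^ 8 + c ^ 4)" for x y :: real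
    proof -
      have sq: "(p - q)\<^sup>2 \<le> 2 * (p\<^sup>2 + q\<^sup>2)" for p q :: real
        using zero_le_power2[of "p + q"] by (simp add: power2_sum power2_diff)
      have sq': "(p + q)\<^sup>2 \<le> 2 * (p\<^sup>2 + q\<^sup>2)" for p q :: real
        using zero_le_power2[of "p - q"] by (simp add: power2_sum power2_diff)
      have "(x * y - c) ^ 4 = ((x * y - c)\<^sup>2)\<^sup>2"
        by (simp flip: power_mult)
      also have "\<dots> \<le> (2 * ((x * y)\<^sup>2 + c\<^sup>2))\<^sup>2"
        by (intro power_mono sq) simp
      also have "\<dots> = 4 * ((x * y)\<^sup>2 + c\<^sup>2)\<^sup>2"
        by (simp only: power_mult_distrib[of 2]) simp
      also have "\<dots> \<le> 4 * (2 * (((x * y)\<^sup>2)\<^sup>2 + (c\<^sup>2)\<^sup>2))"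
        by (intro mult_left_mono sq') simp
      also have "\<dots> = 8 * (x ^ 4 * y ^ 4 + c ^ 4)"
        by (simp add: power_mult_distrib flip: power_mult)
      also have "x ^ 4 * y ^ 4 \<le> x ^ 8 + y ^ 8"
      proof -
        have "0 \<le> (x ^ 4 - y ^ 4)\<^sup>2" by simp
        then have "2 * (x ^ 4 * y ^ 4) \<le> x ^ 8 + y ^ 8"
          by (simp add: power2_diff flip: power_mult)
        moreover have "0 \<le> x ^ 8 + y ^ 8" by simp
        ultimately show ?thesis by linarith
      qed
      finally show ?thesis by simp
    qed
    then have "\<bar>((u \<bullet> X w) * (v \<bullet> X w) - c) ^ 4\<bar> \<le> \<bar>8 * ((u \<bullet> X w) ^ 8 + (v \<bullet> X w) ^ 8 + c ^ 4)\<bar>" for w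
      by (subst abs_of_nonneg) (simp, rule order_trans[OF _ abs_ge_self])
    then show "AE w in M. norm (((u \<bullet> X w) * (v \<bullet> X w) - c) ^ 4) \<le> norm (8 * ((u \<bullet> X w) ^ 8 + (v \<bullet> X w) ^ 8 + c ^ 4))"
      by (intro AE_I2) (simp only: real_norm_def)
  qed simp
qed

theorem (in prob_space) mvn_sample_covariance_converges:
  fixes X :: "nat \<Rightarrow> 'a \<Rightarrow> real^'n" and S :: "real^'n^'n"
  assumes pd: "pos_def S"
    and ind: "indep_vars (\<lambda>_. borel) X {1..}"
    and D: "\<And>i. i \<ge> 1 \<Longrightarrow> distributed M lborel (X i) (\<lambda>x. ennreal (mvn_density 0 S x))"
  shows "AE w in M. (\<lambda>n. (\<Sum>i=1..n. (u \<bullet> X i w) * (v \<bullet> X i w)) / real n) \<longlonglongrightarrow> u \<bullet> (S *v v)"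
proof -
  define c where "c = u \<bullet> (S *v v)"
  define h where "h = (\<lambda>x. (u \<bullet> x) * (v \<bullet> x) - c)"
  have [measurable]: "h \<in> borel_measurable borel"
    unfolding h_def by measurable
  \<comment> \<open>An integral against the common density, hence one bound for all
    \<open>i\<close>, as the strong law demands.\<close>
  define K where "K = (\<integral>x. mvn_density 0 S x * h x ^ 4 \<partial>lborel)"
  have "AE w in M. (\<lambda>n. (\<Sum>i=1..n. h (X i w)) / real n) \<longlonglongrightarrow> 0"
  proof (rule strong_law_fourth_moment)
    show "indep_vars (\<lambda>_. borel) (\<lambda>i w. h (X i w)) {1..}"
      by (rule indep_vars_compose2[OF ind]) simp
  next
    fix i :: nat assume i: "i \<ge> 1"
    show "integrable M (\<lambda>w. h (X i w) ^ 4)"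
      unfolding h_def by (rule mvn_mixed_moments(3)[OF pd D[OF i]])
    show "expectation (\<lambda>w. h (X i w)) = 0"
      unfolding h_def using mvn_mixed_moments(1,2)[OF pd D[OF i], of u v] by (simp add: c_def prob_space)
    have "K = expectation (\<lambda>w. h (X i w) ^ 4)"
      unfolding K_def using pos_def_det[OF pd]
      by (intro distributed_integral[OF D[OF i]]) (simp_all add: mvn_density_pos less_imp_le)
    then show "expectation (\<lambda>w. h (X i w) ^ 4) \<le> K" by simp
  qed
  then show ?thesis
  proof eventually_elim
    case (elim w)
    then have "(\<lambda>n. (\<Sum>i=1..n. h (X i w)) / real n + c) \<longlonglongrightarrow> 0 + c"
      by (intro tendsto_add tendsto_const)
    \<comment> \<open>Removing the centring needs \<open>n > 0\<close>: at \<open>n = 0\<close> the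
      left side is \<open>c\<close> and the right side is 0.\<close>
    moreover have "\<forall>\<^sub>F n in sequentially. (\<Sum>i=1..n. h (X i w)) / real n + c =
        (\<Sum>i=1..n. (u \<bullet> X i w) * (v \<bullet> X i w)) / real n"
      using eventually_gt_at_top[of 0]
    proof eventually_elim
      case (elim n)
      then show ?case
        by (simp add: h_def sum_subtractf field_simps)
    qed
    ultimately show ?case
      unfolding c_def[symmetric] by (simp add: filterlim_cong[OF refl refl])
  qed
qed

section \<open>Consistency of the covariance\<close>

lemma ln_mvn_density_ratio:
  fixes S S' :: "real^'n^'n"
  assumes S: "0 < det S" and S': "0 < det S'"
  shows "2 * ln (mvn_density 0 S x / mvn_density 0 S' x) =
    x \<bullet> (matrix_inv S' *v x) - x \<bullet> (matrix_inv S *v x) + ln (det S') - ln (det S)"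
proof -
  have ln: "ln (mvn_density 0 A x) = - (x \<bullet> (matrix_inv A *v x)) / 2 - (ln ((2 * pi) ^ CARD('n)) + ln (det A)) / 2"
    if "0 < det A" for A :: "real^'n^'n"
    using that by (simp add: mvn_density_def ln_div ln_sqrt ln_mult)
  show ?thesis
    by (simp add: ln_divide_pos mvn_density_pos S S' ln field_simps)
qed

text \<open>A quantitative form of \<open>ln s \<le> s - 1\<close>, obtained by applying that
  inequality to \<open>sqrt s\<close>. It turns a small deviance into closeness of \<open>s\<close>
  to 1 without a case split on the size of \<open>s\<close>.\<close>

lemma sqrt_minus_one_power2_le:
  fixes s :: real
  assumes "0 < s"
  shows "(sqrt s - 1)\<^sup>2 \<le> s - 1 - ln s"
proof -
  have "ln s = 2 * ln (sqrt s)"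
    using assms by (simp add: ln_sqrt)
  also have "\<dots> \<le> 2 * (sqrt s - 1)"
    using ln_le_minus_one[of "sqrt s"] assms by simp
  finally show ?thesis
    using assms by (simp add: power2_diff)
qed

text \<open>
  The deviance bound forces the eigenvalues \<open>e\<close> of the whitened covariance towards \<open>1\<close>.
  Here \<open>\<delta>\<close> measures how far the whitened sample covariance is from the identity.
\<close>

lemma likelihood_bounds_eigenvalues:
  fixes S S0 R :: "real^'n^'n" and x :: "nat \<Rightarrow> real^'n"
  assumes pd: "pos_def S" and pd0: "pos_def S0" and R: "transpose R ** S0 ** R = mat 1"
    and n: "0 < n" and c: "0 < c"
    and lik: "c \<le> (\<Prod>i=1..n. mvn_density 0 S (x i) / mvn_density 0 S0 (x i))"
    and \<delta>: "\<delta> < 1"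
    and lower: "\<And>v. norm v = 1 \<Longrightarrow> real n * (1 - \<delta>) \<le> (\<Sum>i=1..n. (v \<bullet> (transpose R *v x i))\<^sup>2)"
    and upper: "(\<Sum>i=1..n. (norm (transpose R *v x i))\<^sup>2) \<le> real n * (real CARD('n) + \<delta>)"
  shows "\<exists>V e. orthogonal_matrix V \<and> (\<forall>k. 0 < e k) \<and> transpose V ** (transpose R ** S ** R) ** V = diag_mat e \<and>
    (\<Sum>k\<in>UNIV. (sqrt ((1 - \<delta>) / e k) - 1)\<^sup>2) \<le> \<delta> - 2 * ln c / real n - real CARD('n) * ln (1 - \<delta>)"
proof -
  define y where "y = (\<lambda>i. transpose R *v x i)"
  have R1: "transpose R ** S0 ** R = diag_mat (\<lambda>i. 1)" by (simp add: R)
  have invR: "invertible R"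
    by (rule congruence_diag_inverse(3)[OF R1]) simp
  obtain V :: "real^'n^'n" and e where V: "orthogonal_matrix V" and e: "\<And>k. 0 < e k"
    and diag: "transpose V ** (transpose R ** S ** R) ** V = diag_mat e"
    using pos_def_diagonalization[OF pos_def_congruence[OF pd invR]] by blast
  \<comment> \<open>\<open>Q\<close> diagonalizes both covariances at once: it turns
    \<open>S0\<close> into the identity, since \<open>V\<close> is orthogonal, and \<open>S\<close>
    into \<open>diag_mat e\<close>.\<close>
  define Q where "Q = R ** V"
  have Q: "transpose Q ** S ** Q = diag_mat e"
    by (simp only: Q_def matrix_transpose_mul diag[symmetric] matrix_mul_assoc)
  \<comment> \<open>Consequently both log-determinants carry the same term
    \<open>ln ((det R)\<^sup>2)\<close>, and their difference is the sum of the
    \<open>ln (e k)\<close>.\<close>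
  have "(det V)\<^sup>2 = 1"
    using det_orthogonal_matrix[OF V] by auto
  then have detQ: "(det Q)\<^sup>2 = (det R)\<^sup>2"
    by (simp add: Q_def det_mul power_mult_distrib)
  have detR: "0 < (det R)\<^sup>2"
    using invR by (simp add: invertible_det_nz)
  have "det S * (det R)\<^sup>2 = (\<Prod>k\<in>UNIV. e k)"
    using congruence_diag_inverse(2)[OF Q e] by (simp only: detQ)
  moreover have "ln (det S * (det R)\<^sup>2) = ln (det S) + ln ((det R)\<^sup>2)"
    by (intro ln_mult_pos pos_def_det[OF pd] detR)
  moreover have "ln (\<Prod>k\<in>UNIV. e k) = (\<Sum>k\<in>UNIV. ln (e k))"
    using e by (intro ln_prod) (auto simp: less_imp_neq[THEN not_sym])
  ultimately have lnS: "ln (det S) = (\<Sum>k\<in>UNIV. ln (e k)) - ln ((det R)\<^sup>2)"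
    by simp
  have "det S0 * (det R)\<^sup>2 = (\<Prod>k\<in>(UNIV::'n set). 1)"
    by (rule congruence_diag_inverse(2)[OF R1]) simp
  moreover have "ln (det S0 * (det R)\<^sup>2) = ln (det S0) + ln ((det R)\<^sup>2)"
    by (intro ln_mult_pos pos_def_det[OF pd0] detR)
  ultimately have lnS0: "ln (det S0) = - ln ((det R)\<^sup>2)"
    by simp
  have q0: "x i \<bullet> (matrix_inv S0 *v x i) = (norm (y i))\<^sup>2" for i
  proof -
    have "x i \<bullet> (matrix_inv S0 *v x i) = (\<Sum>k\<in>UNIV. (y i $ k)\<^sup>2 / 1)"
      unfolding y_def by (rule congruence_diag_quadratic_form[OF R1]) simp
    then show ?thesis
      unfolding power2_norm_eq_inner inner_vec_def[of "y i"] by (simp add: power2_eq_square)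
  qed
  have "(transpose Q *v x i) $ k = column k V \<bullet> y i" for i k
  proof -
    have "transpose Q *v x i = transpose V *v y i"
      by (simp only: Q_def y_def matrix_transpose_mul matrix_vector_mul_assoc)
    then show ?thesis
      by (simp add: matrix_vector_mul_component column_def transpose_def del: transpose_matrix_vector)
  qed
  then have q: "x i \<bullet> (matrix_inv S *v x i) = (\<Sum>k\<in>UNIV. (column k V \<bullet> y i)\<^sup>2 / e k)" for i
    by (subst congruence_diag_quadratic_form[OF Q e]) simp
  have pos: "0 < mvn_density 0 S (x i) / mvn_density 0 S0 (x i)" for i
    by (intro divide_pos_pos mvn_density_pos pos_def_det pd pd0)
  have ratio: "2 * ln (mvn_density 0 S (x i) / mvn_density 0 S0 (x i)) =
      (norm (y i))\<^sup>2 - (\<Sum>k\<in>UNIV. (column k V \<bullet> y i)\<^sup>2 / e k) - (\<Sum>k\<in>UNIV. ln (e k))" for i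
    using ln_mvn_density_ratio[OF pos_def_det[OF pd] pos_def_det[OF pd0], of "x i"]
    unfolding q q0 lnS lnS0 by linarith
  have "2 * ln c \<le> 2 * ln (\<Prod>i=1..n. mvn_density 0 S (x i) / mvn_density 0 S0 (x i))"
    using ln_mono[OF lik c] by simp
  also have "\<dots> = (\<Sum>i=1..n. 2 * ln (mvn_density 0 S (x i) / mvn_density 0 S0 (x i)))"
    by (subst ln_prod[OF _ less_imp_neq[OF pos, symmetric]]) (simp_all add: sum_distrib_left)
  also have "\<dots> = (\<Sum>i=1..n. (norm (y i))\<^sup>2 - (\<Sum>k\<in>UNIV. (column k V \<bullet> y i)\<^sup>2 / e k) - (\<Sum>k\<in>UNIV. ln (e k)))"
    by (intro sum.cong refl ratio)
  also have "\<dots> = (\<Sum>i=1..n. (norm (y i))\<^sup>2) - (\<Sum>i=1..n. \<Sum>k\<in>UNIV. (column k V \<bullet> y i)\<^sup>2 / e k)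
      - real n * (\<Sum>k\<in>UNIV. ln (e k))"
    by (simp add: sum_subtractf)
  also have "(\<Sum>i=1..n. \<Sum>k\<in>UNIV. (column k V \<bullet> y i)\<^sup>2 / e k) = (\<Sum>k\<in>UNIV. (\<Sum>i=1..n. (column k V \<bullet> y i)\<^sup>2) / e k)"
    by (subst sum.swap) (simp only: sum_divide_distrib)
  also have "(\<Sum>i=1..n. (norm (y i))\<^sup>2) - (\<Sum>k\<in>UNIV. (\<Sum>i=1..n. (column k V \<bullet> y i)\<^sup>2) / e k) - real n * (\<Sum>k\<in>UNIV. ln (e k))
    \<le> real n * (real CARD('n) + \<delta>) - (\<Sum>k\<in>UNIV. real n * (1 - \<delta>) / e k) - real n * (\<Sum>k\<in>UNIV. ln (e k))"
  proof -
    \<comment> \<open>These directions vary with the fitted covariance, which is why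
      \<open>lower\<close> is assumed for every unit vector.\<close>
    have "norm (column k V) = 1" for k
      using V by (simp add: orthogonal_matrix_orthonormal_columns)
    then have "(\<Sum>k\<in>UNIV. real n * (1 - \<delta>) / e k) \<le> (\<Sum>k\<in>UNIV. (\<Sum>i=1..n. (column k V \<bullet> y i)\<^sup>2) / e k)"
      unfolding y_def by (intro sum_mono divide_right_mono lower less_imp_le[OF e])
    with upper show ?thesis
      unfolding y_def by linarith
  qed
  also have "\<dots> = real n * (\<delta> - (\<Sum>k\<in>UNIV. (1 - \<delta>) / e k + ln (e k) - 1))"
    by (simp add: sum.distrib sum_subtractf algebra_simps sum_distrib_left)
  finally have "2 * ln c / real n \<le> \<delta> - (\<Sum>k\<in>UNIV. (1 - \<delta>) / e k + ln (e k) - 1)"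
    using n by (simp add: field_simps)
  \<comment> \<open>The factor \<open>1 - \<delta>\<close> is absorbed into
    \<open>s = (1 - \<delta>) / e k\<close>, at the price of one \<open>ln (1 - \<delta>)\<close>
    per eigenvalue.\<close>
  moreover have "(\<Sum>k\<in>UNIV. (sqrt ((1 - \<delta>) / e k) - 1)\<^sup>2) \<le> (\<Sum>k\<in>UNIV. (1 - \<delta>) / e k - 1 - ln ((1 - \<delta>) / e k))"
    using e \<delta> by (intro sum_mono sqrt_minus_one_power2_le) simp
  moreover have "(\<Sum>k\<in>UNIV. (1 - \<delta>) / e k - 1 - ln ((1 - \<delta>) / e k))
      = (\<Sum>k\<in>UNIV. ((1 - \<delta>) / e k + ln (e k) - 1) - ln (1 - \<delta>))"
    using e \<delta> by (intro sum.cong refl) (simp add: ln_divide_pos)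
  moreover have "\<dots> = (\<Sum>k\<in>UNIV. (1 - \<delta>) / e k + ln (e k) - 1) - real CARD('n) * ln (1 - \<delta>)"
    by (simp only: sum_subtractf sum_constant)
  ultimately have "(\<Sum>k\<in>UNIV. (sqrt ((1 - \<delta>) / e k) - 1)\<^sup>2) \<le> \<delta> - 2 * ln c / real n - real CARD('n) * ln (1 - \<delta>)"
    by linarith
  with V e diag show ?thesis by blast
qed


section \<open>From whitened sample moments to convergence of covariances\<close>

lemma quadratic_form_sum:
  fixes y :: "nat \<Rightarrow> real^'n"
  shows "(\<Sum>i\<in>I. (v \<bullet> y i)\<^sup>2) = (\<Sum>a\<in>UNIV. \<Sum>b\<in>UNIV. v $ a * v $ b * (\<Sum>i\<in>I. y i $ a * y i $ b))"
proof -
  have "(\<Sum>i\<in>I. (v \<bullet> y i)\<^sup>2) = (\<Sum>i\<in>I. \<Sum>a\<in>UNIV. \<Sum>b\<in>UNIV. v $ a * v $ b * (y i $ a * y i $ b))"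
    by (simp add: inner_vec_def power2_eq_square sum_product mult_ac)
  also have "\<dots> = (\<Sum>a\<in>UNIV. \<Sum>i\<in>I. \<Sum>b\<in>UNIV. v $ a * v $ b * (y i $ a * y i $ b))"
    by (rule sum.swap)
  also have "\<dots> = (\<Sum>a\<in>UNIV. \<Sum>b\<in>UNIV. \<Sum>i\<in>I. v $ a * v $ b * (y i $ a * y i $ b))"
    by (intro sum.cong refl sum.swap)
  finally show ?thesis
    by (simp only: sum_distrib_left)
qed

text \<open>Coordinates of a unit vector are at most 1 in absolute value, so the entrywise sum
  \<delta> bounds the error of the quadratic form in all directions simultaneously. The second claim
  is the trace, where the diagonal errors are again at most \<delta> in total.\<close>

lemma near_identity_second_moments:
  fixes y :: "nat \<Rightarrow> real^'n"
  assumes n: "0 < n"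
    and \<delta>: "\<delta> = (\<Sum>a\<in>UNIV. \<Sum>b\<in>UNIV. \<bar>(\<Sum>i=1..n. y i $ a * y i $ b) / real n - mat 1 $ a $ b\<bar>)"
  shows "norm v = 1 \<Longrightarrow> real n * (1 - \<delta>) \<le> (\<Sum>i=1..n. (v \<bullet> y i)\<^sup>2)"
    and "(\<Sum>i=1..n. (norm (y i))\<^sup>2) \<le> real n * (real CARD('n) + \<delta>)"
proof -
  define D where "D = (\<lambda>a b. (\<Sum>i=1..n. y i $ a * y i $ b) / real n - mat 1 $ a $ b)"
  have T: "(\<Sum>i=1..n. y i $ a * y i $ b) = real n * (D a b + mat 1 $ a $ b)" for a b
    using n by (simp add: D_def)
  have \<delta>D: "\<delta> = (\<Sum>a\<in>UNIV. \<Sum>b\<in>UNIV. \<bar>D a b\<bar>)"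
    by (simp only: \<delta> D_def)
  show "real n * (1 - \<delta>) \<le> (\<Sum>i=1..n. (v \<bullet> y i)\<^sup>2)" if v: "norm v = 1"
  proof -
    have le1: "\<bar>v $ a\<bar> \<le> 1" for a
      using component_le_norm_cart[of v a] v by simp
    have "v $ a * v $ b * D a b \<ge> - \<bar>D a b\<bar>" for a b
    proof -
      have "\<bar>v $ a * v $ b\<bar> \<le> 1"
        using mult_mono[OF le1[of a] le1[of b]] by (simp add: abs_mult)
      then have "\<bar>v $ a * v $ b * D a b\<bar> \<le> 1 * \<bar>D a b\<bar>"
        unfolding abs_mult[of "v $ a * v $ b"] by (intro mult_right_mono) auto
      then show ?thesis by linarith
    qed
    then have "(\<Sum>a\<in>UNIV. \<Sum>b\<in>UNIV. - \<bar>D a b\<bar>) \<le> (\<Sum>a\<in>UNIV. \<Sum>b\<in>UNIV. v $ a * v $ b * D a b)"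
      by (intro sum_mono)
    then have 1: "- \<delta> \<le> (\<Sum>a\<in>UNIV. \<Sum>b\<in>UNIV. v $ a * v $ b * D a b)"
      by (simp add: \<delta>D sum_negf)
    have "(\<Sum>a\<in>UNIV. \<Sum>b\<in>UNIV. v $ a * v $ b * mat 1 $ a $ b) = v \<bullet> v"
      by (simp add: mat_def inner_vec_def if_distrib cong: if_cong)
    also have "\<dots> = 1"
      using v by (simp add: norm_eq_1)
    finally have 2: "(\<Sum>a\<in>UNIV. \<Sum>b\<in>UNIV. v $ a * v $ b * mat 1 $ a $ b) = 1" .
    have "(\<Sum>i=1..n. (v \<bullet> y i)\<^sup>2) = (\<Sum>a\<in>UNIV. \<Sum>b\<in>UNIV. real n * (v $ a * v $ b * D a b + v $ a * v $ b * mat 1 $ a $ b))"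
      unfolding quadratic_form_sum T by (intro sum.cong refl) (simp add: algebra_simps)
    also have "\<dots> = real n * ((\<Sum>a\<in>UNIV. \<Sum>b\<in>UNIV. v $ a * v $ b * D a b) + 1)"
      by (simp only: sum_distrib_left[symmetric] sum.distrib 2)
    also have "\<dots> \<ge> real n * (1 - \<delta>)"
      using 1 by (intro mult_left_mono) auto
    finally show ?thesis .
  qed
  have "(\<Sum>i=1..n. (norm (y i))\<^sup>2) = (\<Sum>a\<in>UNIV. \<Sum>i=1..n. y i $ a * y i $ a)"
    unfolding power2_norm_eq_inner inner_vec_def by (subst sum.swap) simp
  also have "\<dots> = (\<Sum>a\<in>UNIV. real n * (D a a + 1))"
    by (simp only: T) (simp add: mat_def)
  also have "\<dots> \<le> (\<Sum>a\<in>UNIV. real n * ((\<Sum>b\<in>UNIV. \<bar>D a b\<bar>) + 1))"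
  proof (intro sum_mono mult_left_mono add_right_mono)
    fix a
    have "\<bar>D a a\<bar> \<le> (\<Sum>b\<in>UNIV. \<bar>D a b\<bar>)"
      by (intro member_le_sum) auto
    then show "D a a \<le> (\<Sum>b\<in>UNIV. \<bar>D a b\<bar>)" by linarith
  qed simp
  also have "\<dots> = real n * (real CARD('n) + \<delta>)"
    by (simp only: sum_distrib_left[symmetric] sum.distrib \<delta>D) simp
  finally show "(\<Sum>i=1..n. (norm (y i))\<^sup>2) \<le> real n * (real CARD('n) + \<delta>)" .
qed

text \<open>A statement about one sample path: \<open>S n\<close> may depend on the data in any way,
  and randomness has been reduced to the hypothesis \<open>lln\<close>.\<close>

theorem covariance_consistency:
  fixes S0 R :: "real^'n^'n" and S :: "nat \<Rightarrow> real^'n^'n" and x :: "nat \<Rightarrow> real^'n"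
  assumes pd: "\<And>n. n \<ge> 1 \<Longrightarrow> pos_def (S n)" and pd0: "pos_def S0" and R: "transpose R ** S0 ** R = mat 1"
    and c: "0 < c"
    and lik: "\<And>n. n \<ge> 1 \<Longrightarrow> c \<le> (\<Prod>i=1..n. mvn_density 0 (S n) (x i) / mvn_density 0 S0 (x i))"
    and lln: "\<And>a b. (\<lambda>n. (\<Sum>i=1..n. (transpose R *v x i) $ a * (transpose R *v x i) $ b) / real n) \<longlonglongrightarrow> mat 1 $ a $ b"
  shows "S \<longlonglongrightarrow> S0"
proof -
  define \<delta> where "\<delta> = (\<lambda>n. \<Sum>a\<in>UNIV. \<Sum>b\<in>UNIV.
    \<bar>(\<Sum>i=1..n. (transpose R *v x i) $ a * (transpose R *v x i) $ b) / real n - mat 1 $ a $ b\<bar>)"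
  have "\<delta> \<longlonglongrightarrow> (\<Sum>a\<in>(UNIV::'n set). \<Sum>b\<in>(UNIV::'n set). \<bar>mat 1 $ a $ b - mat 1 $ a $ b\<bar>)"
    unfolding \<delta>_def by (intro tendsto_sum tendsto_rabs tendsto_diff lln tendsto_const)
  then have \<delta>0: "\<delta> \<longlonglongrightarrow> 0"
    by simp
  \<comment> \<open>The right side of the eigenvalue bound. It vanishes in the limit because
    \<open>c\<close> does not depend on \<open>n\<close>.\<close>
  define \<eta> where "\<eta> = (\<lambda>n. \<delta> n - 2 * ln c / real n - real CARD('n) * ln (1 - \<delta> n))"
  have "\<eta> \<longlonglongrightarrow> 0 - 0 - real CARD('n) * ln (1 - 0)"
    unfolding \<eta>_def
    by (intro tendsto_diff tendsto_mult tendsto_ln \<delta>0 tendsto_const lim_const_over_n) auto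
  then have \<eta>0: "\<eta> \<longlonglongrightarrow> 0"
    by simp
  have ev: "\<forall>\<^sub>F n in sequentially. 1 \<le> n \<and> \<delta> n < 1"
    using order_tendstoD(2)[OF \<delta>0, of 1] by (intro eventually_conj eventually_ge_at_top) auto
  define good where "good = (\<lambda>n V e. orthogonal_matrix V \<and> (\<forall>k. 0 < e k) \<and>
    transpose V ** (transpose R ** S n ** R) ** V = diag_mat e \<and>
    (\<Sum>k\<in>UNIV. (sqrt ((1 - \<delta> n) / e k) - 1)\<^sup>2) \<le> \<eta> n)"
  \<comment> \<open>The implication sits under the quantifiers so that \<open>V\<close> and
    \<open>e\<close> can be chosen for every \<open>n\<close>; the excluded indices are eventually
    left behind.\<close>
  have "\<forall>n. \<exists>V e. 1 \<le> n \<and> \<delta> n < 1 \<longrightarrow> good n V e"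
  proof
    fix n
    show "\<exists>V e. 1 \<le> n \<and> \<delta> n < 1 \<longrightarrow> good n V e"
    proof (cases "1 \<le> n \<and> \<delta> n < 1")
      case True
      then have n: "1 \<le> n" "0 < n" and d: "\<delta> n < 1" by auto
      note m = near_identity_second_moments[OF n(2), of "\<delta> n" "\<lambda>i. transpose R *v x i", OF \<delta>_def[THEN fun_cong]]
      show ?thesis
        using likelihood_bounds_eigenvalues[OF pd[OF n(1)] pd0 R n(2) c lik[OF n(1)] d m]
        unfolding good_def \<eta>_def by blast
    qed auto
  qed
  then obtain V e where Ve: "\<And>n. 1 \<le> n \<and> \<delta> n < 1 \<Longrightarrow> good n (V n) (e n)"
    by metis
  have ev_good: "\<forall>\<^sub>F n in sequentially. good n (V n) (e n) \<and> \<delta> n < 1"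
    using ev by eventually_elim (auto intro: Ve)
  have e1: "(\<lambda>n. e n k) \<longlonglongrightarrow> 1" for k
  proof -
    \<comment> \<open>The bound controls \<open>r\<close>, and \<open>e n k\<close> is recovered
      from it as \<open>(1 - \<delta> n) / (r n)\<^sup>2\<close>.\<close>
    define r where "r = (\<lambda>n. sqrt ((1 - \<delta> n) / e n k))"
    have "(\<lambda>n. (r n - 1)\<^sup>2) \<longlonglongrightarrow> 0"
    proof (rule tendsto_sandwich[OF _ _ tendsto_const \<eta>0])
      show "\<forall>\<^sub>F n in sequentially. (r n - 1)\<^sup>2 \<le> \<eta> n"
        using ev_good
      proof eventually_elim
        case (elim n)
        have "(r n - 1)\<^sup>2 \<le> (\<Sum>k\<in>UNIV. (sqrt ((1 - \<delta> n) / e n k) - 1)\<^sup>2)"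
          unfolding r_def by (rule member_le_sum[of k UNIV "\<lambda>k. (sqrt ((1 - \<delta> n) / e n k) - 1)\<^sup>2"]) auto
        with elim show ?case by (simp add: good_def)
      qed
    qed simp
    then have "(\<lambda>n. sqrt ((r n - 1)\<^sup>2)) \<longlonglongrightarrow> sqrt 0"
      by (rule tendsto_real_sqrt)
    then have "(\<lambda>n. r n - 1) \<longlonglongrightarrow> 0"
      by (simp add: tendsto_rabs_zero_iff)
    then have r1: "r \<longlonglongrightarrow> 1"
      by (rule LIM_zero_cancel)
    have "(\<lambda>n. (1 - \<delta> n) / (r n)\<^sup>2) \<longlonglongrightarrow> (1 - 0) / 1\<^sup>2"
      by (intro tendsto_intros \<delta>0 r1) auto
    moreover have "\<forall>\<^sub>F n in sequentially. (1 - \<delta> n) / (r n)\<^sup>2 = e n k"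
      using ev_good
    proof eventually_elim
      case (elim n)
      then have "0 < e n k" by (simp add: good_def)
      with elim show ?case by (simp add: r_def)
    qed
    ultimately show ?thesis
      by (simp add: filterlim_cong[OF refl refl])
  qed
  define B where "B = (\<lambda>n. transpose R ** S n ** R)"
  \<comment> \<open>The eigenvectors \<open>V n\<close> need not converge. Since entries of
    orthogonal matrices are bounded by 1, the deviation of \<open>B n\<close> from the identity is
    controlled by the eigenvalues alone.\<close>
  have Bab: "(\<lambda>n. B n $ a $ b) \<longlonglongrightarrow> mat 1 $ a $ b" for a b
  proof (rule Lim_null_comparison[of "\<lambda>n. B n $ a $ b - mat 1 $ a $ b" _ sequentially, THEN LIM_zero_cancel])
    show "\<forall>\<^sub>F n in sequentially. norm (B n $ a $ b - mat 1 $ a $ b) \<le> (\<Sum>k\<in>UNIV. \<bar>e n k - 1\<bar>)"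
      using ev_good
    proof eventually_elim
      case (elim n)
      define W where "W = V n"
      have orth: "transpose W ** W = mat 1" "W ** transpose W = mat 1"
        using elim by (auto simp: good_def orthogonal_matrix_def W_def)
      have diag: "transpose W ** B n ** W = diag_mat (e n)"
        using elim unfolding good_def B_def W_def by blast
      have "W ** (transpose W ** B n ** W) ** transpose W = (W ** transpose W) ** B n ** (W ** transpose W)"
        by (simp only: matrix_mul_assoc)
      then have Bn: "B n = W ** diag_mat (e n) ** transpose W"
        by (simp only: diag orth matrix_mul_lid matrix_mul_rid)
      have ent: "(W ** diag_mat d ** transpose W) $ a $ b = (\<Sum>k\<in>UNIV. W $ a $ k * d k * W $ b $ k)" for d
      proof -
        have "(W ** diag_mat d) $ a $ k = W $ a $ k * d k" for k
          by (simp add: matrix_matrix_mult_def diag_mat_def if_distrib cong: if_cong)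
        then show ?thesis
          by (simp add: matrix_matrix_mult_def[of "W ** diag_mat d"] transpose_def)
      qed
      have "mat 1 = W ** diag_mat (\<lambda>k. 1) ** transpose W"
        by (simp add: orth)
      then have "B n $ a $ b - mat 1 $ a $ b = (\<Sum>k\<in>UNIV. W $ a $ k * (e n k - 1) * W $ b $ k)"
        unfolding Bn by (simp only: ent sum_subtractf[symmetric]) (simp add: algebra_simps)
      also have "\<bar>\<dots>\<bar> \<le> (\<Sum>k\<in>UNIV. \<bar>W $ a $ k * (e n k - 1) * W $ b $ k\<bar>)"
        by (rule sum_abs)
      also have "\<dots> \<le> (\<Sum>k\<in>UNIV. \<bar>e n k - 1\<bar>)"
      proof (rule sum_mono)
        fix k
        have le1: "\<bar>W $ i $ k\<bar> \<le> 1" for i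
        proof -
          have "norm (column k W) = 1"
            using elim by (simp add: good_def orthogonal_matrix_orthonormal_columns W_def)
          then show ?thesis
            using component_le_norm_cart[of "column k W" i] by (simp add: column_def)
        qed
        have "\<bar>W $ a $ k * W $ b $ k\<bar> \<le> 1"
          using mult_mono[OF le1[of a] le1[of b]] by (simp add: abs_mult)
        then have "\<bar>W $ a $ k * W $ b $ k\<bar> * \<bar>e n k - 1\<bar> \<le> 1 * \<bar>e n k - 1\<bar>"
          by (intro mult_right_mono) auto
        then show "\<bar>W $ a $ k * (e n k - 1) * W $ b $ k\<bar> \<le> \<bar>e n k - 1\<bar>"
          by (simp add: abs_mult mult_ac)
      qed
      finally show ?case by simp
    qed
    have "(\<lambda>n. \<Sum>k\<in>UNIV. \<bar>e n k - 1\<bar>) \<longlonglongrightarrow> (\<Sum>k\<in>(UNIV::'n set). \<bar>1 - 1\<bar>)"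
      by (intro tendsto_intros e1)
    then show "(\<lambda>n. \<Sum>k\<in>UNIV. \<bar>e n k - 1\<bar>) \<longlonglongrightarrow> 0"
      by simp
  qed
  have "invertible R"
    by (rule congruence_diag_inverse(3)[of R S0 "\<lambda>i. 1"]) (simp_all add: R)
  then obtain P where P: "R ** P = mat 1" "P ** R = mat 1"
    unfolding invertible_def by blast
  have tP: "transpose P ** transpose R = mat 1"
    using arg_cong[OF P(1), of transpose] by (simp only: matrix_transpose_mul transpose_mat)
  have undo: "transpose P ** (transpose R ** A ** R) ** P = A" for A
  proof -
    have "transpose P ** (transpose R ** A ** R) ** P = (transpose P ** transpose R) ** A ** (R ** P)"
      by (simp only: matrix_mul_assoc)
    then show ?thesis by (simp only: tP P(1) matrix_mul_lid matrix_mul_rid)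
  qed
  have "(\<lambda>n. transpose P ** B n ** P) \<longlonglongrightarrow> transpose P ** mat 1 ** P"
    unfolding matrix_matrix_mult_def by (intro tendsto_vec_lambda tendsto_sum tendsto_mult tendsto_const Bab) (simp only: vec_lambda_beta, intro tendsto_intros Bab)
  then show ?thesis
    unfolding B_def undo R[symmetric] .
qed

section \<open>Convergence in the quotient space\<close>

lemma model_cov_quadratic_form:
  fixes \<theta> :: "('p::finite, 'q::finite) param"
  shows "x \<bullet> (model_cov \<theta> *v x) = (norm (transpose (fst \<theta>) *v x))\<^sup>2 + snd \<theta> * (x \<bullet> x)"
proof -
  have "model_cov \<theta> *v x = fst \<theta> *v (transpose (fst \<theta>) *v x) + snd \<theta> *\<^sub>R x"
    by (simp add: model_cov_def matrix_vector_mult_add_rdistrib matrix_vector_mul_assoc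
        scaleR_matrix_vector_assoc[symmetric] del: transpose_matrix_vector)
  then show ?thesis
    by (simp only: inner_add_right inner_scaleR_right dot_matrix_vector_transpose[of x] power2_norm_eq_inner)
qed

lemma pos_def_model_cov:
  fixes \<theta> :: "('p::finite, 'q::finite) param"
  assumes "\<theta> \<in> Theta"
  shows "pos_def (model_cov \<theta>)"
proof -
  have "transpose (model_cov \<theta>) = model_cov \<theta>"
  proof -
    have "transpose (A + B) = transpose A + transpose B" for A B :: "real^'p^'p"
      by (simp add: transpose_def vec_eq_iff)
    then show ?thesis
      by (simp add: model_cov_def matrix_transpose_mul transpose_scalar)
  qed
  moreover have "0 < x \<bullet> (model_cov \<theta> *v x)" if "x \<noteq> 0" for x
    unfolding model_cov_quadratic_form using assms that by (intro add_nonneg_pos) (auto simp: Theta_def)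
  ultimately show ?thesis
    by (simp add: pos_def_def)
qed

text \<open>The trace of \<open>W W^T\<close> is the squared Euclidean norm of \<open>W\<close>, so
  a bound on the covariance trace confines the parameter to a ball.\<close>

lemma norm_param_le:
  fixes \<theta> :: "('p::finite, 'q::finite) param"
  assumes "0 \<le> snd \<theta>"
  shows "norm \<theta> \<le> 1 + 2 * trace (model_cov \<theta>)"
proof -
  have "trace (model_cov \<theta>) = trace (fst \<theta> ** transpose (fst \<theta>)) + real CARD('p) * snd \<theta>"
    by (simp add: model_cov_def trace_def mat_def sum.distrib)
  also have "trace (fst \<theta> ** transpose (fst \<theta>)) = (norm (fst \<theta>))\<^sup>2"
    by (simp add: trace_def matrix_matrix_mult_def transpose_def power2_norm_eq_inner inner_vec_def)
  finally have tr: "trace (model_cov \<theta>) = (norm (fst \<theta>))\<^sup>2 + real CARD('p) * snd \<theta>" .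
  have "norm (fst \<theta>) \<le> 1 + (norm (fst \<theta>))\<^sup>2"
    using zero_le_power2[of "norm (fst \<theta>) - 1 / 2"] by (simp add: power2_diff power_divide)
  moreover have "1 * snd \<theta> \<le> real CARD('p) * snd \<theta>"
    using assms by (intro mult_right_mono) (auto simp: Suc_le_eq)
  moreover have "norm \<theta> \<le> norm (fst \<theta>) + norm (snd \<theta>)"
    using norm_Pair_le[of "fst \<theta>" "snd \<theta>"] by simp
  moreover have "0 \<le> (norm (fst \<theta>))\<^sup>2" by simp
  ultimately show ?thesis
    using tr assms unfolding real_norm_def by linarith
qed

text \<open>Since \<open>q < p\<close>, \<open>W W\<^sup>T\<close> is singular, so the noise variance cannot degenerate to \<open>0\<close> in the limit.\<close>

lemma noise_variance_pos:
  fixes \<theta> :: "('p::finite, 'q::finite) param"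
  assumes "CARD('q) < CARD('p)" and pd: "pos_def (model_cov \<theta>)"
  shows "0 < snd \<theta>"
proof -
  have "rank (transpose (fst \<theta>)) < CARD('p)"
    using rank_bound[of "transpose (fst \<theta>)"] assms(1) by linarith
  then have "\<not> inj ((*v) (transpose (fst \<theta>)))"
    by (rule less_rank_noninjective[THEN iffD1])
  then obtain a b where ab: "a \<noteq> b" "transpose (fst \<theta>) *v a = transpose (fst \<theta>) *v b"
    unfolding inj_def by blast
  define x where "x = a - b"
  have x: "x \<noteq> 0" "transpose (fst \<theta>) *v x = 0"
    using ab by (simp_all add: x_def matrix_vector_mult_diff_distrib del: transpose_matrix_vector)
  have "x \<bullet> (model_cov \<theta> *v x) = snd \<theta> * (x \<bullet> x)"
    unfolding model_cov_quadratic_form x(2) by simp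
  moreover have "0 < x \<bullet> (model_cov \<theta> *v x)"
    using pd x(1) by (simp add: pos_def_def)
  ultimately show ?thesis
    using inner_ge_zero[of x] by (simp add: zero_less_mult_iff)
qed

lemma continuous_model_cov: "continuous_on UNIV (model_cov :: ('p::finite, 'q::finite) param \<Rightarrow> _)"
  unfolding model_cov_def matrix_matrix_mult_def transpose_def
  by (intro continuous_intros)

text \<open>Parameters at distance at least \<epsilon> from the true set, within a suitable ball,
  form a compact set on which the covariance stays a positive distance from the true one. Convergent
  covariances have bounded trace, so the parameters eventually lie in the ball and must leave this
  set.\<close>

lemma infdist_true_set_tendsto:
  fixes \<theta>\<^sub>0 :: "('p::finite, 'q::finite) param" and \<phi> :: "nat \<Rightarrow> ('p, 'q) param"
  assumes card: "CARD('q) < CARD('p)" and \<theta>0: "\<theta>\<^sub>0 \<in> Theta"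
    and \<phi>: "\<And>n. n \<ge> 1 \<Longrightarrow> \<phi> n \<in> Theta"
    and lim: "(\<lambda>n. model_cov (\<phi> n)) \<longlonglongrightarrow> model_cov \<theta>\<^sub>0"
  shows "(\<lambda>n. infdist (\<phi> n) (true_set \<theta>\<^sub>0)) \<longlonglongrightarrow> 0"
proof (rule order_tendstoI)
  show "\<forall>\<^sub>F n in sequentially. a < infdist (\<phi> n) (true_set \<theta>\<^sub>0)" if "a < 0" for a
    using that infdist_nonneg by (intro always_eventually) (auto intro: less_le_trans)
next
  fix \<epsilon> :: real assume \<epsilon>: "0 < \<epsilon>"
  define t where "t = trace (model_cov \<theta>\<^sub>0) + 1"
  define K where "K = cball 0 (1 + 2 * t) \<inter> {\<theta> :: ('p, 'q) param. 0 \<le> snd \<theta>} \<inter> {\<theta>. \<epsilon> \<le> infdist \<theta> (true_set \<theta>\<^sub>0)}"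
  have "compact K"
    unfolding K_def
    by (intro compact_Int_closed compact_cball closed_Collect_le continuous_intros)
  moreover have cont: "continuous_on K (\<lambda>\<theta>. dist (model_cov \<theta>) (model_cov \<theta>\<^sub>0))"
    by (intro continuous_intros continuous_on_subset[OF continuous_model_cov]) auto
  moreover have pos: "0 < dist (model_cov \<theta>) (model_cov \<theta>\<^sub>0)" if "\<theta> \<in> K" for \<theta>
  proof (rule ccontr)
    assume "\<not> 0 < dist (model_cov \<theta>) (model_cov \<theta>\<^sub>0)"
    then have eq: "model_cov \<theta> = model_cov \<theta>\<^sub>0" by simp
    then have "0 < snd \<theta>"
      using noise_variance_pos[OF card] pos_def_model_cov[OF \<theta>0] by metis
    then have "\<theta> \<in> true_set \<theta>\<^sub>0"
      using eq by (simp add: true_set_def Theta_def mem_Times_iff)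
    then show False
      using that \<epsilon> by (simp add: K_def)
  qed
  ultimately have "\<exists>m>0. \<forall>\<theta>\<in>K. m \<le> dist (model_cov \<theta>) (model_cov \<theta>\<^sub>0)"
  proof (cases "K = {}")
    case False
    then obtain z where "z \<in> K" "\<forall>\<theta>\<in>K. dist (model_cov z) (model_cov \<theta>\<^sub>0) \<le> dist (model_cov \<theta>) (model_cov \<theta>\<^sub>0)"
      using continuous_attains_inf[OF \<open>compact K\<close> _ cont] by blast
    then show ?thesis using pos by blast
  qed (auto intro: exI[of _ 1])
  then obtain m where m: "0 < m" "\<And>\<theta>. \<theta> \<in> K \<Longrightarrow> m \<le> dist (model_cov \<theta>) (model_cov \<theta>\<^sub>0)"
    by blast
  have "(\<lambda>n. trace (model_cov (\<phi> n))) \<longlonglongrightarrow> trace (model_cov \<theta>\<^sub>0)"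
    unfolding trace_def by (intro tendsto_sum tendsto_vec_nth lim)
  then have "\<forall>\<^sub>F n in sequentially. trace (model_cov (\<phi> n)) < t"
    by (rule order_tendstoD(2)) (simp add: t_def)
  moreover have "\<forall>\<^sub>F n in sequentially. dist (model_cov (\<phi> n)) (model_cov \<theta>\<^sub>0) < m"
    by (rule tendstoD[OF lim m(1)])
  ultimately show "\<forall>\<^sub>F n in sequentially. infdist (\<phi> n) (true_set \<theta>\<^sub>0) < \<epsilon>"
    using eventually_ge_at_top[of 1]
  proof eventually_elim
    case (elim n)
    have "0 \<le> snd (\<phi> n)"
      using \<phi>[OF elim(3)] by (auto simp: Theta_def)
    moreover from this have "norm (\<phi> n) \<le> 1 + 2 * t"
      using norm_param_le[of "\<phi> n"] elim(1) by linarith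
    moreover have "\<phi> n \<notin> K"
      using m(2)[of "\<phi> n"] elim(2) by linarith
    ultimately show ?case
      by (auto simp: K_def)
  qed
qed

section \<open>Measurability and modes of convergence\<close>

text \<open>Testing only the radii \<open>1 / real (Suc k)\<close> makes the event a countable
  combination of measurable sets; this is what upgrades an almost-everywhere statement to
  probability exactly 1.\<close>

lemma LIMSEQ_zero_set_measurable:
  fixes f :: "nat \<Rightarrow> 'a \<Rightarrow> real"
  assumes [measurable]: "\<And>n. f n \<in> borel_measurable M"
  shows "{w \<in> space M. (\<lambda>n. f n w) \<longlonglongrightarrow> 0} \<in> sets M"
proof -
  have "(\<lambda>n. f n w) \<longlonglongrightarrow> 0 \<longleftrightarrow> (\<forall>k::nat. \<exists>N. \<forall>n\<ge>N. \<bar>f n w\<bar> < 1 / real (Suc k))" for w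
  proof
    assume "(\<lambda>n. f n w) \<longlonglongrightarrow> 0"
    then show "\<forall>k::nat. \<exists>N. \<forall>n\<ge>N. \<bar>f n w\<bar> < 1 / real (Suc k)"
      by (auto simp: LIMSEQ_def)
  next
    assume *: "\<forall>k::nat. \<exists>N. \<forall>n\<ge>N. \<bar>f n w\<bar> < 1 / real (Suc k)"
    show "(\<lambda>n. f n w) \<longlonglongrightarrow> 0"
      unfolding LIMSEQ_def
    proof (intro allI impI)
      fix r :: real assume "0 < r"
      then obtain k where k: "1 / real (Suc k) < r"
        using nat_approx_posE by blast
      obtain N where "\<forall>n\<ge>N. \<bar>f n w\<bar> < 1 / real (Suc k)"
        using * by blast
      with k show "\<exists>N. \<forall>n\<ge>N. dist (f n w) 0 < r"
        by (intro exI[of _ N]) force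
    qed
  qed
  then show ?thesis by simp
qed

text \<open>Along almost every path the indicator of the exceptional event is eventually 0, and
  dominated convergence applies with the constant 1.\<close>

lemma (in prob_space) AE_LIMSEQ_zero_imp_in_probability:
  fixes f :: "nat \<Rightarrow> 'a \<Rightarrow> real"
  assumes [measurable]: "\<And>n. f n \<in> borel_measurable M"
    and lim: "AE w in M. (\<lambda>n. f n w) \<longlonglongrightarrow> 0" and \<epsilon>: "0 < \<epsilon>"
  shows "(\<lambda>n. prob {w \<in> space M. f n w > \<epsilon>}) \<longlonglongrightarrow> 0"
proof -
  define A where "A = (\<lambda>n. {w \<in> space M. f n w > \<epsilon>})"
  have [measurable]: "A n \<in> sets M" for n
    unfolding A_def by measurable
  have "(\<lambda>n. expectation (\<lambda>w. indicator (A n) w :: real)) \<longlonglongrightarrow> expectation (\<lambda>w. 0)"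
  proof (rule integral_dominated_convergence[where w = "\<lambda>_. 1"])
    show "AE w in M. (\<lambda>n. indicator (A n) w :: real) \<longlonglongrightarrow> 0"
      using lim
    proof eventually_elim
      case (elim w)
      have "\<forall>\<^sub>F n in sequentially. f n w < \<epsilon>"
        by (rule order_tendstoD(2)[OF elim \<epsilon>])
      then have "\<forall>\<^sub>F n in sequentially. (indicator (A n) w :: real) = 0"
        by eventually_elim (auto simp: A_def)
      then show ?case
        by (rule tendsto_eventually)
    qed
  qed (auto simp: indicator_def)
  then show ?thesis
    by (simp add: A_def)
qed

theorem theorem5p2:
  fixes M :: "'a measure"
    and X :: "nat \<Rightarrow> 'a \<Rightarrow> real ^ 'p"
    and \<theta>\<^sub>0 :: "('p::finite, 'q::finite) param"
    and T :: "nat \<Rightarrow> (nat \<Rightarrow> real ^ 'p) \<Rightarrow> ('p, 'q) param"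
    and \<theta> :: "nat \<Rightarrow> 'a \<Rightarrow> ('p, 'q) param"
    and c :: real
  assumes "CARD('q) < CARD('p)"
    and "\<theta>\<^sub>0 \<in> Theta"
    and "prob_space M"
    and "prob_space.indep_vars M (\<lambda>_. borel) X {1..}"
    and "\<And>i. i \<ge> 1 \<Longrightarrow> distributed M lborel (X i) (\<lambda>x. ennreal (ppca_density x \<theta>\<^sub>0))"
    and "\<And>n. n \<ge> 1 \<Longrightarrow> T n \<in> measurable (Pi\<^sub>M {1..n} (\<lambda>_. borel)) (restrict_space borel Theta)"
    and "\<And>n \<omega>. n \<ge> 1 \<Longrightarrow> \<omega> \<in> space M \<Longrightarrow> \<theta> n \<omega> = T n (\<lambda>i\<in>{1..n}. X i \<omega>)"
    and "c > 0"
    and "AE \<omega> in M. \<forall>n\<ge>1. (\<Prod>i=1..n. ppca_density (X i \<omega>) (\<theta> n \<omega>) / ppca_density (X i \<omega>) \<theta>\<^sub>0) \<ge> c"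
  shows "measure M {\<omega> \<in> space M.
            limitin (Metric_space.mtopology (collapse Theta (true_set \<theta>\<^sub>0)) (collapse_dist (true_set \<theta>\<^sub>0)))
              (\<lambda>n. collapse_class Theta (true_set \<theta>\<^sub>0) (\<theta> n \<omega>))
              (collapse_class Theta (true_set \<theta>\<^sub>0) \<theta>\<^sub>0) sequentially} = 1
       \<and> (\<forall>\<epsilon>>0. (\<lambda>n. measure M {\<omega> \<in> space M.
            collapse_dist (true_set \<theta>\<^sub>0) (collapse_class Theta (true_set \<theta>\<^sub>0) (\<theta> n \<omega>))
              (collapse_class Theta (true_set \<theta>\<^sub>0) \<theta>\<^sub>0) > \<epsilon>}) \<longlonglongrightarrow> 0)"
proof -
  interpret prob_space M by fact
  define C where "C = true_set \<theta>\<^sub>0"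
  define S0 where "S0 = model_cov \<theta>\<^sub>0"
  have pd0: "pos_def S0"
    unfolding S0_def by (rule pos_def_model_cov) fact
  obtain R :: "real^'p^'p" where R: "transpose R ** S0 ** R = mat 1"
    using pos_def_whitening[OF pd0] by blast
  have rvX: "X i \<in> borel_measurable M" if "i \<ge> 1" for i
    using assms(4) that by (auto simp: indep_vars_def)
  have sample: "(\<lambda>\<omega>. \<lambda>i\<in>{1..n}. X i \<omega>) \<in> measurable M (Pi\<^sub>M {1..n} (\<lambda>_. borel))" for n
    by (intro measurable_restrict rvX) simp
  have T\<theta>: "(\<lambda>\<omega>. T n (\<lambda>i\<in>{1..n}. X i \<omega>)) \<in> measurable M (restrict_space borel Theta)" if "n \<ge> 1" for n
    using measurable_compose[OF sample assms(6)[OF that]] .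
  \<comment> \<open>Membership is encoded in the codomain of \<open>T n\<close>, the Borel space
    restricted to \<open>Theta\<close>.\<close>
  have \<theta>Theta: "\<theta> n \<omega> \<in> Theta" if "n \<ge> 1" "\<omega> \<in> space M" for n \<omega>
    using T\<theta>[OF that(1)] that assms(7)[OF that] by (auto simp: measurable_restrict_space2_iff)
  have \<theta>meas: "\<theta> n \<in> borel_measurable M" if "n \<ge> 1" for n
  proof -
    have "(\<lambda>\<omega>. T n (\<lambda>i\<in>{1..n}. X i \<omega>)) \<in> borel_measurable M"
      using T\<theta>[OF that] by (simp add: measurable_restrict_space2_iff)
    then show ?thesis
      using assms(7)[OF that] by (simp cong: measurable_cong)
  qed
  have lln: "AE \<omega> in M. \<forall>a b. (\<lambda>n. (\<Sum>i=1..n. (transpose R *v X i \<omega>) $ a * (transpose R *v X i \<omega>) $ b) / real n)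
      \<longlonglongrightarrow> mat 1 $ a $ b"
  \<comment> \<open>The index type is finite, so the exceptional null sets of the individual entries
    can be merged.\<close>
  proof (unfold AE_all_countable, intro allI)
    fix a b
    have col: "(transpose R *v x) $ k = column k R \<bullet> x" for k x
      by (simp add: matrix_vector_mul_component column_def transpose_def del: transpose_matrix_vector)
    have "column a R \<bullet> (S0 *v column b R) = (transpose R *v (S0 *v (R *v axis b 1))) $ a"
      by (simp only: col matrix_vector_mult_basis)
    also have "transpose R *v (S0 *v (R *v axis b 1)) = mat 1 *v axis b 1"
      by (simp only: R matrix_vector_mul_assoc matrix_mul_assoc)
    also have "(mat 1 *v axis b 1) $ a = (mat 1 :: real^'p^'p) $ a $ b"
      by (simp add: matrix_vector_mult_basis column_def)
    finally have ab: "column a R \<bullet> (S0 *v column b R) = mat 1 $ a $ b" .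
    have D: "distributed M lborel (X i) (\<lambda>x. ennreal (mvn_density 0 S0 x))" if "i \<ge> 1" for i
      using assms(5)[OF that] by (simp only: ppca_density_def S0_def)
    show "AE \<omega> in M. (\<lambda>n. (\<Sum>i=1..n. (transpose R *v X i \<omega>) $ a * (transpose R *v X i \<omega>) $ b) / real n)
      \<longlonglongrightarrow> mat 1 $ a $ b"
      unfolding col ab[symmetric] by (rule mvn_sample_covariance_converges[OF pd0 assms(4) D])
  qed
  have inf: "AE \<omega> in M. (\<lambda>n. infdist (\<theta> n \<omega>) C) \<longlonglongrightarrow> 0"
    using lln assms(9) AE_space
  proof eventually_elim
    case (elim \<omega>)
    have "(\<lambda>n. model_cov (\<theta> n \<omega>)) \<longlonglongrightarrow> S0"
    proof (rule covariance_consistency[OF _ pd0 R \<open>0 < c\<close>])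
      show "pos_def (model_cov (\<theta> n \<omega>))" if "n \<ge> 1" for n
        by (intro pos_def_model_cov \<theta>Theta that elim(3))
      show "c \<le> (\<Prod>i=1..n. mvn_density 0 (model_cov (\<theta> n \<omega>)) (X i \<omega>) / mvn_density 0 S0 (X i \<omega>))"
        if "n \<ge> 1" for n
        using elim(2) that by (simp only: ppca_density_def S0_def)
      show "(\<lambda>n. (\<Sum>i=1..n. (transpose R *v X i \<omega>) $ a * (transpose R *v X i \<omega>) $ b) / real n)
          \<longlonglongrightarrow> mat 1 $ a $ b" for a b
        using elim(1) by blast
    qed
    then show ?case
      unfolding C_def S0_def
      by (intro infdist_true_set_tendsto assms(1,2)) (auto intro: \<theta>Theta elim(3))
  qed
  have CS: "C \<subseteq> Theta" and \<theta>0C: "\<theta>\<^sub>0 \<in> C"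
    using assms(2) by (auto simp: C_def true_set_def)
  define d where "d = (\<lambda>n \<omega>. collapse_dist C (collapse_class Theta C (\<theta> n \<omega>)) (collapse_class Theta C \<theta>\<^sub>0))"
  \<comment> \<open>As \<open>\<theta>\<^sub>0\<close> lies in \<open>C\<close>, its own distance to
    \<open>C\<close> drops out of the sum.\<close>
  have d: "d n \<omega> = min (dist (\<theta> n \<omega>) \<theta>\<^sub>0) (infdist (\<theta> n \<omega>) C)" if "n \<ge> 1" "\<omega> \<in> space M" for n \<omega>
    unfolding d_def using \<theta>0C by (subst collapse_dist_class[OF CS \<theta>Theta[OF that] assms(2)]) simp
  \<comment> \<open>The index is shifted because nothing is assumed about \<open>\<theta> 0\<close>,
    neither measurability nor membership in \<open>Theta\<close>.\<close>
  have dmeas: "d (Suc n) \<in> borel_measurable M" for n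
  proof -
    have [measurable]: "\<theta> (Suc n) \<in> borel_measurable M"
      by (rule \<theta>meas) simp
    have [measurable]: "(\<lambda>\<omega>. infdist (\<theta> (Suc n) \<omega>) C) \<in> borel_measurable M"
      by (intro borel_measurable_continuous_on[where f = "\<lambda>x. infdist x C"] continuous_intros) measurable
    have "(\<lambda>\<omega>. min (dist (\<theta> (Suc n) \<omega>) \<theta>\<^sub>0) (infdist (\<theta> (Suc n) \<omega>) C)) \<in> borel_measurable M"
      by measurable
    then show ?thesis
      by (simp add: d cong: measurable_cong)
  qed
  have dlim: "AE \<omega> in M. (\<lambda>n. d (Suc n) \<omega>) \<longlonglongrightarrow> 0"
    using inf AE_space
  proof eventually_elim
    case (elim \<omega>)
    show ?case
    proof (rule tendsto_sandwich[OF _ _ tendsto_const LIMSEQ_Suc[OF elim(1)]])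
      show "\<forall>\<^sub>F n in sequentially. 0 \<le> d (Suc n) \<omega>"
        by (simp add: d elim infdist_nonneg)
      show "\<forall>\<^sub>F n in sequentially. d (Suc n) \<omega> \<le> infdist (\<theta> (Suc n) \<omega>) C"
        by (simp add: d elim)
    qed
  qed
  interpret Q: Metric_space "collapse Theta C" "collapse_dist C"
    unfolding C_def by (rule Metric_space_true_set) fact
  \<comment> \<open>Convergence in the metric topology also asks that the classes eventually belong
    to the quotient, which holds from index 1 on.\<close>
  have lim_iff: "limitin Q.mtopology (\<lambda>n. collapse_class Theta C (\<theta> n \<omega>)) (collapse_class Theta C \<theta>\<^sub>0) sequentially
      \<longleftrightarrow> (\<lambda>n. d (Suc n) \<omega>) \<longlonglongrightarrow> 0" if \<omega>: "\<omega> \<in> space M" for \<omega>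
  proof -
    have in0: "collapse_class Theta C \<theta>\<^sub>0 \<in> collapse Theta C"
      using assms(2) by (simp add: collapse_eq)
    have ev: "\<forall>\<^sub>F n in sequentially. collapse_class Theta C (\<theta> n \<omega>) \<in> collapse Theta C"
      using eventually_ge_at_top[of 1] by eventually_elim (simp add: collapse_eq \<theta>Theta \<omega>)
    have "limitin Q.mtopology (\<lambda>n. collapse_class Theta C (\<theta> n \<omega>)) (collapse_class Theta C \<theta>\<^sub>0) sequentially
      \<longleftrightarrow> (\<forall>\<epsilon>>0. \<forall>\<^sub>F n in sequentially. d n \<omega> < \<epsilon>)"
      unfolding Q.limitin_metric d_def using in0 ev by (auto simp: eventually_conj_iff)
    also have "\<dots> \<longleftrightarrow> (\<lambda>n. d n \<omega>) \<longlonglongrightarrow> 0"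
      unfolding tendsto_iff by (simp add: d_def)
    also have "\<dots> \<longleftrightarrow> (\<lambda>n. d (Suc n) \<omega>) \<longlonglongrightarrow> 0"
      by (rule filterlim_sequentially_Suc[symmetric])
    finally show ?thesis .
  qed
  have set_eq: "{\<omega> \<in> space M. limitin Q.mtopology (\<lambda>n. collapse_class Theta C (\<theta> n \<omega>))
      (collapse_class Theta C \<theta>\<^sub>0) sequentially} = {\<omega> \<in> space M. (\<lambda>n. d (Suc n) \<omega>) \<longlonglongrightarrow> 0}"
    using lim_iff by blast
  have "prob {\<omega> \<in> space M. limitin Q.mtopology (\<lambda>n. collapse_class Theta C (\<theta> n \<omega>))
      (collapse_class Theta C \<theta>\<^sub>0) sequentially} = 1"
    unfolding set_eq using dlim by (simp add: prob_Collect_eq_1 LIMSEQ_zero_set_measurable dmeas)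
  moreover have "(\<lambda>n. prob {\<omega> \<in> space M. d n \<omega> > \<epsilon>}) \<longlonglongrightarrow> 0" if "0 < \<epsilon>" for \<epsilon>
    using AE_LIMSEQ_zero_imp_in_probability[OF dmeas dlim that] by (rule LIMSEQ_imp_Suc)
  ultimately show ?thesis
    by (simp add: d_def C_def)
qed

end
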